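(* Let $p$ be an odd prime and let $0<\alpha\le 1$ be fixed. There exist functions $a(n),b(n),c(n)$, depending only on $p$ and $\alpha$ and tending to $0$ as $n\to\infty$, such that the following holds. Let $S\subseteq \mathbb{F}_{p^n}$ be a set such that $\Lambda_3(1_S)$ is minimal among all subsets $S'\subseteq\mathbb{F}_{p^n}$ satisfying $|S'|\ge \alpha p^n$, and $|S|\ge \alpha p^n$. Then there exist a subgroup (equivalently, $\mathbb{F}_p$-subspace) $W\le \mathbb{F}_{p^n}$ with $\dim W\ge n-a(n)\,n$ and a set $A\subseteq\mathbb{F}_{p^n}$ with $|A|\le p^{b(n)\,n}$ such that $$|S\,\Delta\,(A+W)|\le c(n)\,p^n,$$ where $\Delta$ denotes symmetric difference. (In the paper's notation: $\dim W=n-o(n)$, $|A|=p^{o(n)}$, $|S\,\Delta\,(A+W)|=o(p^n)$ as $n\to\infty$ with $p,\alpha$ fixed.)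
   Context: $\mathbb{F}_{p^n}$ is regarded as an $n$-dimensional vector space over $\mathbb{F}_p$. For $f:\mathbb{F}_{p^n}\to[0,1]$, $\Lambda_3(f)=p^{-2n}\sum_{m,d\in\mathbb{F}_{p^n}} f(m)f(m+d)f(m+2d)$; $1_S$ is the indicator function of $S$, so $\Lambda_3(1_S)$ is the normalized number of (possibly trivial) three-term arithmetic progressions in $S$. *)

theory Defs
  imports "HOL-Analysis.Analysis" "HOL-Computational_Algebra.Primes"
begin

text \<open>The additive group of F_(p^n), i.e. the n-dimensional F_p-vector space F_p^n,
  modelled as functions nat => nat with coordinates i < n in {0..<p} and zero elsewhere.\<close>
definition Vsp :: "nat \<Rightarrow> nat \<Rightarrow> (nat \<Rightarrow> nat) set" where
  "Vsp p n = {x. (\<forall>i<n. x i < p) \<and> (\<forall>i\<ge>n. x i = 0)}"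

definition vadd :: "nat \<Rightarrow> (nat \<Rightarrow> nat) \<Rightarrow> (nat \<Rightarrow> nat) \<Rightarrow> (nat \<Rightarrow> nat)" where
  "vadd p x y = (\<lambda>i. (x i + y i) mod p)"

definition vzero :: "nat \<Rightarrow> nat" where
  "vzero = (\<lambda>i. 0)"

definition Lambda3 :: "nat \<Rightarrow> nat \<Rightarrow> ((nat \<Rightarrow> nat) \<Rightarrow> real) \<Rightarrow> real" where
  "Lambda3 p n f = (\<Sum>m\<in>Vsp p n. \<Sum>d\<in>Vsp p n.
       f m * f (vadd p m d) * f (vadd p (vadd p m d) d)) / real p ^ (2 * n)"

text \<open>Subgroups of (F_p^n, +); these are exactly the F_p-subspaces.\<close>
definition is_subgroup :: "nat \<Rightarrow> nat \<Rightarrow> (nat \<Rightarrow> nat) set \<Rightarrow> bool" where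
  "is_subgroup p n W \<longleftrightarrow> W \<subseteq> Vsp p n \<and> vzero \<in> W \<and>
     (\<forall>x\<in>W. \<forall>y\<in>W. vadd p x y \<in> W) \<and>
     (\<forall>x\<in>W. \<exists>y\<in>W. vadd p x y = vzero)"

definition sub_dim :: "nat \<Rightarrow> (nat \<Rightarrow> nat) set \<Rightarrow> nat" where
  "sub_dim p W = (THE k. card W = p ^ k)"

definition sumset :: "nat \<Rightarrow> (nat \<Rightarrow> nat) set \<Rightarrow> (nat \<Rightarrow> nat) set \<Rightarrow> (nat \<Rightarrow> nat) set" where
  "sumset p A W = {vadd p a w | a w. a \<in> A \<and> w \<in> W}"

end

theory Submission
  imports Defs "HOL-Number_Theory.Cong"
begin

text \<open>Let \<open>f = 1\<^sub>S\<close>. There is a subgroup \<open>W\<close> of bounded codimension such that \<open>f\<close> minus its average \<open>g\<close>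
  over the cosets of \<open>W\<close> has only small Fourier coefficients, so \<open>g\<close> has essentially as many
  progressions as \<open>S\<close>. If \<open>\<phi> = g (1 - g)\<close> had large mean, then by Varnavides' theorem \<open>\<phi>\<close> would
  contain a positive proportion of all progressions. Adding to \<open>g\<close> the function \<open>\<phi> (1/p - 1\<^sub>H)\<close>,
  whose average over each coset of \<open>W\<close> is zero, keeps the values in \<open>[0,1]\<close> and the mean, and
  lowers the number of progressions by a multiple of that of \<open>\<phi>\<close>; rounding the result to a set
  contradicts the minimality of \<open>S\<close>. Hence \<open>g\<close> is nearly \<open>{0,1}\<close>-valued, and \<open>S\<close> is close to the
  union of the cosets of \<open>W\<close> on which \<open>g \<ge> 1/2\<close>.\<close>

text \<open>The cross terms between a \<open>W\<close>-invariant \<open>g\<close> and a mean-zero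
  \<open>b\<close> vanish, so a competitor with fewer progressions only requires
  \<open>T b b b < 0\<close>. The form is cubic, so a mean-zero function of positive value may be
  negated; a hyperplane H supplies one, since it carries more progressions than a random set of
  density 1/p. The weight \<phi> is at most min(g, 1 - g), which is why g + b stays in [0,1]. The
  gain is a fixed multiple of p^(2n). It has to beat a loss of at most sqrt \<eta> p^(2n) from the
  Fourier coefficients and of 4 p^n from rounding. Hence \<eta> depends only on the gain, and the
  codimension, at most 1/\<eta>, is bounded independently of n. Rounding must not let the size fall
  below |S|, so mass is exchanged between points with the total kept exact, instead of rounding at
  random.\<close>

lemma sum_product3:
  fixes a b c :: "_ \<Rightarrow> 'a :: semiring_0"
  shows "sum a A * sum b B * sum c C = (\<Sum>x\<in>A. \<Sum>y\<in>B. \<Sum>z\<in>C. a x * b y * c z)"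
proof -
  have "sum a A * sum b B * sum c C = (\<Sum>x\<in>A. \<Sum>y\<in>B. a x * b y) * sum c C"
    by (simp only: sum_product)
  also have "\<dots> = (\<Sum>x\<in>A. \<Sum>y\<in>B. a x * b y * sum c C)"
    by (simp only: sum_distrib_right)
  finally show ?thesis
    by (simp only: sum_distrib_left)
qed

section \<open>The group F_p^n, its subgroups and their cosets\<close>

locale fpn =
  fixes p n :: nat
  assumes prime_p: "prime p" and odd_p: "odd p"
begin

abbreviation V :: "(nat \<Rightarrow> nat) set" where "V \<equiv> Vsp p n"

abbreviation add :: "(nat \<Rightarrow> nat) \<Rightarrow> (nat \<Rightarrow> nat) \<Rightarrow> nat \<Rightarrow> nat" (infixl "\<oplus>" 65)
  where "x \<oplus> y \<equiv> vadd p x y"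

text \<open>Negation is \<open>smul (p - Suc 0)\<close> and multiplication by -2 is
  \<open>smul (p - 2)\<close>, so vectors keep natural coordinates and need no subtraction of their
  own.\<close>

definition smul :: "nat \<Rightarrow> (nat \<Rightarrow> nat) \<Rightarrow> nat \<Rightarrow> nat" where
  "smul c x = (\<lambda>i. (c * x i) mod p)"

lemma p_gt_2: "p > 2"
  using prime_ge_2_nat[OF prime_p] odd_p by (cases "p = 2") auto

lemma p_pos [simp]: "0 < p"
  using p_gt_2 by simp

lemma add_closed: "x \<in> V \<Longrightarrow> y \<in> V \<Longrightarrow> x \<oplus> y \<in> V"
  by (auto simp: Vsp_def vadd_def)

lemma smul_closed: "x \<in> V \<Longrightarrow> smul c x \<in> V"
  by (auto simp: Vsp_def smul_def)

lemma vzero_in [simp]: "vzero \<in> V"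
  by (auto simp: Vsp_def vzero_def)

lemma add_assoc: "x \<oplus> y \<oplus> z = x \<oplus> (y \<oplus> z)"
  by (simp add: vadd_def mod_simps add.assoc)

lemma add_comm: "x \<oplus> y = y \<oplus> x"
  by (simp add: vadd_def add.commute)

lemma add_zero: "x \<in> V \<Longrightarrow> x \<oplus> vzero = x"
proof
  fix i assume "x \<in> V"
  then show "(x \<oplus> vzero) i = x i"
    by (cases "i < n") (auto simp: Vsp_def vadd_def vzero_def)
qed

lemma add_neg: "x \<oplus> smul (p - Suc 0) x = vzero"
proof
  fix i
  have "x i + (p - Suc 0) * x i = p * x i"
    using p_pos by (metis Suc_pred mult_Suc)
  then show "(x \<oplus> smul (p - Suc 0) x) i = vzero i"
    by (simp add: vadd_def smul_def vzero_def mod_simps)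
qed

lemma add_cancel:
  assumes "x \<in> V" "y \<in> V" "x \<oplus> a = y \<oplus> a" shows "x = y"
proof -
  have "x \<oplus> a \<oplus> smul (p - Suc 0) a = y \<oplus> a \<oplus> smul (p - Suc 0) a"
    using assms by simp
  then show ?thesis
    using assms(1,2) by (simp add: add_assoc add_neg add_zero)
qed

lemma V_card_finite: "finite V \<and> card V = p ^ n"
proof -
  have "bij_betw (\<lambda>x. restrict x {..<n}) V ({..<n} \<rightarrow>\<^sub>E {..<p})"
    by (rule bij_betwI[where g = "\<lambda>y i. if i < n then y i else 0"])
       (auto simp: Vsp_def PiE_def extensional_def fun_eq_iff restrict_def)
  then show ?thesis
    using bij_betw_finite bij_betw_same_card finite_PiE[of "{..<n}" "\<lambda>_. {..<p}"]
      card_PiE[of "{..<n}" "\<lambda>_. {..<p}"] by fastforce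
qed

lemma finite_V [simp]: "finite V" and card_V: "card V = p ^ n"
  using V_card_finite by auto

abbreviation sg :: "(nat \<Rightarrow> nat) set \<Rightarrow> bool" where "sg W \<equiv> is_subgroup p n W"

lemma sg_V: "sg V"
  unfolding is_subgroup_def using vzero_in add_closed add_neg smul_closed by blast

lemma sg_sub: "sg W \<Longrightarrow> W \<subseteq> V"
  and sg_zero: "sg W \<Longrightarrow> vzero \<in> W"
  and sg_add: "sg W \<Longrightarrow> x \<in> W \<Longrightarrow> y \<in> W \<Longrightarrow> x \<oplus> y \<in> W"
  by (auto simp: is_subgroup_def)

lemma sg_finite: "sg W \<Longrightarrow> finite W"
  using sg_sub finite_V finite_subset by blast

lemma sg_card_pos: "sg W \<Longrightarrow> card W > 0"
  using sg_finite sg_zero card_gt_0_iff by blast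

lemma sg_neg:
  assumes "sg W" "x \<in> W" shows "smul (p - Suc 0) x \<in> W"
proof -
  obtain y where y: "y \<in> W" "x \<oplus> y = vzero"
    using assms by (auto simp: is_subgroup_def)
  have "y = smul (p - Suc 0) x"
    using add_cancel[of y "smul (p - Suc 0) x" x] y assms sg_sub smul_closed add_neg add_comm
    by (metis subsetD)
  then show ?thesis using y by simp
qed

lemma sg_mem_iff:
  assumes "sg W" "x \<in> V" "w \<in> W" shows "x \<oplus> w \<in> W \<longleftrightarrow> x \<in> W"
proof
  assume "x \<oplus> w \<in> W"
  then have "x \<oplus> w \<oplus> smul (p - Suc 0) w \<in> W"
    using assms sg_neg sg_add by blast
  then show "x \<in> W"
    using assms by (simp add: add_assoc add_neg add_zero)
qed (use assms sg_add in blast)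

lemma bij_shift:
  assumes "sg W" "a \<in> W" shows "bij_betw (\<lambda>x. x \<oplus> a) W W"
proof -
  have "inj_on (\<lambda>x. x \<oplus> a) W"
    using assms add_cancel sg_sub by (meson inj_onI subsetD)
  moreover have "(\<lambda>x. x \<oplus> a) ` W \<subseteq> W"
    using assms sg_add by auto
  ultimately show ?thesis
    using assms sg_finite endo_inj_surj by (metis bij_betw_def)
qed

lemma sum_shift:
  assumes "sg W" "a \<in> W"
  shows "(\<Sum>x\<in>W. k (x \<oplus> a)) = (\<Sum>x\<in>W. k x)" "(\<Sum>x\<in>W. k (a \<oplus> x)) = (\<Sum>x\<in>W. k x)"
  using sum.reindex_bij_betw[OF bij_shift[OF assms], of k] by (simp_all add: add_comm)

text \<open>The representative \<open>r x\<close> depends only on the coset of \<open>x\<close>, so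
  \<open>A\<close> meets every coset inside \<open>B\<close> exactly once. With \<open>B = V\<close>
  this is Lagrange's theorem; with \<open>B\<close> the union of the dense cosets it yields the
  final set \<open>A\<close> and its size.\<close>

lemma exists_transversal:
  assumes W: "sg W" and B: "B \<subseteq> V" "\<And>x w. x \<in> B \<Longrightarrow> w \<in> W \<Longrightarrow> x \<oplus> w \<in> B"
  shows "\<exists>A \<subseteq> B. sumset p A W = B \<and> card A * card W = card B"
proof -
  define C where "C x = (\<lambda>w. x \<oplus> w) ` W" for x
  define r where "r x = (SOME y. y \<in> C x)" for x
  have C: "C (x \<oplus> w) = C x" if "x \<in> V" "w \<in> W" for x w
  proof -
    have "(\<lambda>v. w \<oplus> v) ` W = W"
      using bij_shift[OF W \<open>w \<in> W\<close>] by (simp add: bij_betw_def add_comm)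
    then show ?thesis
      unfolding C_def by (metis (no_types, lifting) add_assoc image_cong image_image)
  qed
  have r: "r x \<in> C x" if "x \<in> V" for x
    unfolding r_def by (rule someI[of _ "x \<oplus> vzero"]) (use W sg_zero in \<open>auto simp: C_def\<close>)
  have Cr: "C (r x) = C x" if x: "x \<in> V" for x
  proof -
    obtain w where "w \<in> W" "r x = x \<oplus> w" using r[OF x] by (auto simp: C_def)
    then show ?thesis using C x by simp
  qed
  define A where "A = r ` B"
  have AB: "A \<subseteq> B"
    using r B by (force simp: A_def C_def)
  have "bij_betw (\<lambda>(a, w). a \<oplus> w) (A \<times> W) B"
  proof (rule bij_betw_imageI)
    show "inj_on (\<lambda>(a, w). a \<oplus> w) (A \<times> W)"
    proof (rule inj_onI, clarify)
      fix a w a' w' assume *: "a \<in> A" "w \<in> W" "a' \<in> A" "w' \<in> W" "a \<oplus> w = a' \<oplus> w'"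
      then have V: "a \<in> V" "a' \<in> V" "w \<in> V" "w' \<in> V"
        using AB B sg_sub[OF W] by auto
      have "C a = C a'"
        using * C V by metis
      moreover obtain x x' where x: "x \<in> B" "a = r x" "x' \<in> B" "a' = r x'"
        using * by (auto simp: A_def)
      ultimately have "C x = C x'" using Cr B by (metis subsetD)
      then have "a = a'" using x by (simp add: r_def)
      then show "a = a' \<and> w = w'"
        using * V add_cancel[of w w' a] add_comm by metis
    qed
    show "(\<lambda>(a, w). a \<oplus> w) ` (A \<times> W) = B"
    proof
      show "(\<lambda>(a, w). a \<oplus> w) ` (A \<times> W) \<subseteq> B" using AB B by auto
      show "B \<subseteq> (\<lambda>(a, w). a \<oplus> w) ` (A \<times> W)"
      proof
        fix x assume x: "x \<in> B"
        have "x \<in> C x"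
          using x B W sg_zero add_zero by (force simp: C_def)
        then have "x \<in> C (r x)" using Cr x B by auto
        then show "x \<in> (\<lambda>(a, w). a \<oplus> w) ` (A \<times> W)"
          using x by (force simp: C_def A_def)
      qed
    qed
  qed
  then have "card A * card W = card B" "(\<lambda>(a, w). a \<oplus> w) ` (A \<times> W) = B"
    using bij_betw_same_card card_cartesian_product by (metis, metis bij_betw_def)
  moreover have "sumset p A W = (\<lambda>(a, w). a \<oplus> w) ` (A \<times> W)"
    by (auto simp: sumset_def)
  ultimately show ?thesis using AB by auto
qed

lemma sub_dim_eqI: "card W = p ^ k \<Longrightarrow> sub_dim p W = k"
  unfolding sub_dim_def using p_gt_2 by (intro the_equality) auto

text \<open>The order divides p^n, hence is a power of \<open>p\<close>; this makes the definite
  description in \<open>sub_dim\<close> denote the dimension.\<close>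

lemma card_sg:
  assumes "sg W" shows "card W = p ^ sub_dim p W"
proof -
  have "\<exists>A \<subseteq> V. sumset p A W = V \<and> card A * card W = card V"
    using add_closed sg_sub[OF assms] by (intro exists_transversal[OF assms]) auto
  then obtain A :: "(nat \<Rightarrow> nat) set" where "card A * card W = p ^ n"
    by (metis card_V)
  then have "card W dvd p ^ n" by (metis dvd_triv_right)
  then obtain k where "card W = p ^ k"
    using divides_primepow_nat prime_p by blast
  then show ?thesis using sub_dim_eqI by simp
qed

subsection \<open>Fourier analysis\<close>

definition dt :: "(nat \<Rightarrow> nat) \<Rightarrow> (nat \<Rightarrow> nat) \<Rightarrow> nat" where
  "dt t x = (\<Sum>i<n. t i * x i) mod p"

lemma dt_less: "dt t x < p"
  by (simp add: dt_def)

lemma dt_comm: "dt t x = dt x t"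
  by (simp add: dt_def mult.commute)

lemma dt_add: "dt t (x \<oplus> y) = (dt t x + dt t y) mod p"
proof -
  have "dt t (x \<oplus> y) = (\<Sum>i<n. (t i * ((x i + y i) mod p)) mod p) mod p"
    by (simp add: dt_def vadd_def mod_sum_eq)
  also have "\<dots> = (\<Sum>i<n. t i * x i + t i * y i) mod p"
    by (simp add: mod_mult_right_eq mod_sum_eq distrib_left)
  finally show ?thesis
    by (simp add: sum.distrib dt_def mod_simps)
qed

lemma dt_smul: "dt t (smul c x) = (c * dt t x) mod p"
proof -
  have "dt t (smul c x) = (\<Sum>i<n. (t i * ((c * x i) mod p)) mod p) mod p"
    by (simp add: dt_def smul_def mod_sum_eq)
  also have "\<dots> = (\<Sum>i<n. c * (t i * x i)) mod p"
    by (simp add: mod_mult_right_eq mod_sum_eq mult.left_commute)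
  finally show ?thesis
    by (simp add: sum_distrib_left[symmetric] dt_def mod_simps)
qed

lemma dt_zero: "dt t vzero = 0" "dt vzero t = 0"
  by (simp_all add: dt_def vzero_def)

lemma dt_nondegenerate:
  assumes "x \<in> V" "x \<noteq> vzero" shows "\<exists>t\<in>V. dt t x \<noteq> 0"
proof -
  obtain i where i: "x i \<noteq> 0" using assms by (auto simp: vzero_def)
  have "i < n"
  proof (rule ccontr)
    assume "\<not> i < n"
    then show False using i assms by (simp add: Vsp_def)
  qed
  then have "x i < p"
    using assms by (auto simp: Vsp_def)
  define t where "t = (\<lambda>j. if j = i then 1 else 0 :: nat)"
  have "t \<in> V"
    using p_gt_2 \<open>i < n\<close> by (auto simp: t_def Vsp_def)
  moreover have "(\<Sum>j<n. t j * x j) = (\<Sum>j\<in>{i}. t j * x j)"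
    by (rule sum.mono_neutral_right) (use \<open>i < n\<close> in \<open>auto simp: t_def\<close>)
  then have "dt t x = x i"
    using \<open>x i < p\<close> by (simp add: dt_def t_def)
  ultimately show ?thesis using i by (metis)
qed

definition chi :: "(nat \<Rightarrow> nat) \<Rightarrow> (nat \<Rightarrow> nat) \<Rightarrow> complex" where
  "chi t x = cis (2 * pi * real (dt t x) / real p)"

lemma cis_mod: "cis (2 * pi * real (k mod p) / real p) = cis (2 * pi * real k / real p)"
proof -
  have "real k = real p * real (k div p) + real (k mod p)"
    by (metis of_nat_add of_nat_mult mult_div_mod_eq)
  then have "2 * pi * real k / real p = 2 * pi * real (k div p) + 2 * pi * real (k mod p) / real p"
    by (simp add: field_simps)
  then show ?thesis
    by (simp add: cis_mult[symmetric])
qed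

lemma chi_add: "chi t (x \<oplus> y) = chi t x * chi t y"
  by (simp add: chi_def dt_add cis_mod cis_mult add_divide_distrib distrib_left)

lemma chi_comm: "chi t x = chi x t"
  by (simp add: chi_def dt_comm)

lemma chi_smul: "chi t (smul c x) = chi t x ^ c"
  by (simp only: chi_def dt_smul cis_mod Complex.DeMoivre) (rule arg_cong[where f = cis], simp)

lemma norm_chi [simp]: "norm (chi t x) = 1"
  by (simp add: chi_def)

lemma chi_zero: "chi t vzero = 1"
  by (simp add: chi_def dt_zero)

lemma chi_eq_1_iff: "chi t x = 1 \<longleftrightarrow> dt t x = 0"
proof
  assume "chi t x = 1"
  then have "cos (2 * pi * real (dt t x) / real p) = 1"
    by (simp add: chi_def complex_eq_iff)
  then obtain k :: int where "2 * pi * real (dt t x) / real p = of_int k * 2 * pi"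
    using cos_one_2pi_int by auto
  then have "real (dt t x) = of_int k * real p"
    by (simp add: field_simps)
  then have "int (dt t x) = k * int p"
    by (metis of_int_eq_iff of_int_mult of_int_of_nat_eq)
  then have "int p dvd int (dt t x)" by simp
  then show "dt t x = 0"
    using dt_less[of t x] by (metis dvd_imp_le int_dvd_int_iff not_le not_gr_zero)
qed (simp add: chi_def)

lemma chi_neg: "chi t (smul (p - Suc 0) x) = cnj (chi t x)"
proof -
  have "chi t x * chi t (smul (p - Suc 0) x) = 1"
    by (simp add: chi_add[symmetric] add_neg chi_zero)
  moreover have "chi t x * cnj (chi t x) = 1"
    by (simp add: complex_norm_square[symmetric])
  ultimately show ?thesis
    by (metis mult_cancel_left zero_neq_one mult_zero_left)
qed

text \<open>For nonzero \<open>u\<close>, translating the summation variable by some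
  \<open>t\<close> with \<open>dt t u \<noteq> 0\<close> multiplies the sum by
  \<open>chi t u \<noteq> 1\<close>.\<close>

lemma sum_chi:
  assumes "u \<in> V" shows "(\<Sum>t\<in>V. chi t u) = (if u = vzero then of_nat (p ^ n) else 0)"
proof (cases "u = vzero")
  case False
  then obtain t where t: "t \<in> V" "dt t u \<noteq> 0"
    using assms dt_nondegenerate by blast
  have "(\<Sum>s\<in>V. chi s u) = (\<Sum>s\<in>V. chi (s \<oplus> t) u)"
    using sum_shift(1)[OF sg_V t(1), of "\<lambda>s. chi s u"] by simp
  also have "\<dots> = (\<Sum>s\<in>V. chi s u) * chi t u"
    by (simp add: chi_comm[of _ u] chi_add sum_distrib_right)
  finally show ?thesis
    using t False chi_eq_1_iff[of t u] by simp
qed (simp add: chi_zero card_V)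

text \<open>Unnormalised, as is \<open>T\<close> below: coefficients are to be compared with p^n,
  progression counts with p^(2n).\<close>

definition F :: "((nat \<Rightarrow> nat) \<Rightarrow> real) \<Rightarrow> (nat \<Rightarrow> nat) \<Rightarrow> complex" where
  "F f t = (\<Sum>x\<in>V. of_real (f x) * chi t x)"

lemma parseval: "(\<Sum>t\<in>V. (norm (F f t))\<^sup>2) = real p ^ n * (\<Sum>x\<in>V. (f x)\<^sup>2)"
proof -
  have "of_real (\<Sum>t\<in>V. (norm (F f t))\<^sup>2) = (\<Sum>t\<in>V. F f t * cnj (F f t))"
    by (simp add: complex_norm_square del: of_real_power)
  also have "\<dots> = (\<Sum>t\<in>V. \<Sum>x\<in>V. \<Sum>y\<in>V. of_real (f x * f y) * chi t (x \<oplus> smul (p - Suc 0) y))"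
    by (simp add: F_def sum_product chi_add chi_neg mult_ac)
  also have "\<dots> = (\<Sum>x\<in>V. \<Sum>y\<in>V. \<Sum>t\<in>V. of_real (f x * f y) * chi t (x \<oplus> smul (p - Suc 0) y))"
    by (subst sum.swap, rule sum.cong[OF refl], rule sum.swap)
  also have "\<dots> = (\<Sum>x\<in>V. \<Sum>y\<in>V. if y = x then of_real (f x * f y) * of_nat (p ^ n) else 0)"
  proof (intro sum.cong refl)
    fix x y assume xy: "x \<in> V" "y \<in> V"
    have "x \<oplus> smul (p - Suc 0) y = vzero \<longleftrightarrow> y = x"
      using xy add_cancel[of x y "smul (p - Suc 0) y"] add_neg by metis
    then show "(\<Sum>t\<in>V. of_real (f x * f y) * chi t (x \<oplus> smul (p - Suc 0) y)) =
        (if y = x then of_real (f x * f y) * of_nat (p ^ n) else 0 :: complex)"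
      using sum_chi[of "x \<oplus> smul (p - Suc 0) y"] xy add_closed smul_closed
      by (simp add: sum_distrib_left[symmetric])
  qed
  also have "\<dots> = of_real (real p ^ n * (\<Sum>x\<in>V. (f x)\<^sup>2))"
    by (simp add: sum_distrib_left power2_eq_square mult_ac)
  finally show ?thesis
    by (simp only: of_real_eq_iff)
qed

definition T :: "((nat \<Rightarrow> nat) \<Rightarrow> real) \<Rightarrow> ((nat \<Rightarrow> nat) \<Rightarrow> real) \<Rightarrow> ((nat \<Rightarrow> nat) \<Rightarrow> real) \<Rightarrow> real" where
  "T f g h = (\<Sum>m\<in>V. \<Sum>d\<in>V. f m * g (m \<oplus> d) * h (m \<oplus> d \<oplus> d))"

lemma Lambda3_eq: "Lambda3 p n f = T f f f / real p ^ (2 * n)"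
  by (simp add: Lambda3_def T_def)

text \<open>Progressions are the solutions of x - 2y + z = 0, where x - 2y + z is written
  \<open>q x y z\<close>, and summing its characters over all \<open>t\<close> detects them. The
  coefficient -2 becomes the frequency of the middle factor.\<close>

lemma T_fourier:
  "of_real (real p ^ n * T f g h) = (\<Sum>t\<in>V. F f t * F g (smul (p - 2) t) * F h t)"
proof -
  define q where "q x y z = x \<oplus> z \<oplus> smul (p - 2) y" for x y z
  have chi_q: "chi t (q x y z) = chi t x * chi (smul (p - 2) t) y * chi t z" for t x y z
    unfolding q_def chi_add chi_smul chi_comm[of "smul (p - 2) t"] chi_comm[of y t]
    by (simp add: mult_ac)
  have qz: "q x (x \<oplus> d) z = vzero \<longleftrightarrow> z = x \<oplus> d \<oplus> d"
    if "x \<in> V" "d \<in> V" "z \<in> V" for x d z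
  proof -
    have "q x (x \<oplus> d) (x \<oplus> d \<oplus> d) = vzero"
    proof
      fix i
      obtain k where "p = k + 2"
        using p_gt_2 by (metis add.commute less_imp_add_positive)
      then have "x i + (x i + d i + d i) + (p - 2) * (x i + d i) = p * (x i + d i)"
        by (simp add: algebra_simps)
      then show "q x (x \<oplus> d) (x \<oplus> d \<oplus> d) i = vzero i"
        by (simp only: q_def vadd_def smul_def vzero_def mod_simps) simp
    qed
    moreover have "q x (x \<oplus> d) z = z \<oplus> (x \<oplus> smul (p - 2) (x \<oplus> d))" for z
      unfolding q_def by (metis add_assoc add_comm)
    ultimately show ?thesis
      using add_cancel[of z "x \<oplus> d \<oplus> d"] that add_closed by metis
  qed
  let ?c = "\<lambda>x y z. of_real (f x * g y * h z) :: complex"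
  have "(\<Sum>t\<in>V. F f t * F g (smul (p - 2) t) * F h t) =
      (\<Sum>t\<in>V. \<Sum>x\<in>V. \<Sum>y\<in>V. \<Sum>z\<in>V. ?c x y z * chi t (q x y z))"
    by (simp only: F_def sum_product3 chi_q of_real_mult) (simp only: mult_ac)
  also have "\<dots> = (\<Sum>x\<in>V. \<Sum>y\<in>V. \<Sum>z\<in>V. \<Sum>t\<in>V. ?c x y z * chi t (q x y z))"
    by (subst sum.swap, rule sum.cong[OF refl], subst sum.swap, rule sum.cong[OF refl], rule sum.swap)
  also have "\<dots> = (\<Sum>x\<in>V. \<Sum>y\<in>V. \<Sum>z\<in>V. if q x y z = vzero then ?c x y z * of_nat (p ^ n) else 0)"
    by (intro sum.cong refl)
      (simp add: sum_distrib_left[symmetric] sum_chi q_def add_closed smul_closed)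
  \<comment> \<open>Substitute y = x + d; the detecting condition then singles out z = x +
    2d.\<close>
  also have "\<dots> = (\<Sum>x\<in>V. \<Sum>d\<in>V. \<Sum>z\<in>V.
      if q x (x \<oplus> d) z = vzero then ?c x (x \<oplus> d) z * of_nat (p ^ n) else 0)"
    by (intro sum.cong refl sum_shift(2)[OF sg_V, symmetric])
  also have "\<dots> = (\<Sum>x\<in>V. \<Sum>d\<in>V. \<Sum>z\<in>V.
      if z = x \<oplus> d \<oplus> d then ?c x (x \<oplus> d) z * of_nat (p ^ n) else 0)"
    by (intro sum.cong refl if_cong) (simp_all add: qz)
  also have "\<dots> = (\<Sum>x\<in>V. \<Sum>d\<in>V. ?c x (x \<oplus> d) (x \<oplus> d \<oplus> d) * of_nat (p ^ n))"
    by (intro sum.cong refl) (simp add: add_closed)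
  also have "\<dots> = of_real (real p ^ n * T f g h)"
    by (simp add: T_def sum_distrib_left mult_ac)
  finally show ?thesis by simp
qed

subsection \<open>Averages over a subgroup\<close>

definition ann :: "(nat \<Rightarrow> nat) set \<Rightarrow> (nat \<Rightarrow> nat) set" where
  "ann W = {t \<in> V. \<forall>w\<in>W. dt t w = 0}"

definition inv_under :: "(nat \<Rightarrow> nat) set \<Rightarrow> ((nat \<Rightarrow> nat) \<Rightarrow> real) \<Rightarrow> bool" where
  "inv_under W f \<longleftrightarrow> (\<forall>x\<in>V. \<forall>w\<in>W. f (x \<oplus> w) = f x)"

definition mean_zero :: "(nat \<Rightarrow> nat) set \<Rightarrow> ((nat \<Rightarrow> nat) \<Rightarrow> real) \<Rightarrow> bool" where
  "mean_zero W f \<longleftrightarrow> (\<forall>x\<in>V. (\<Sum>w\<in>W. f (x \<oplus> w)) = 0)"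

text \<open>Translation by a \<open>w\<close> in \<open>W\<close> with
  \<open>chi t w \<noteq> 1\<close> preserves \<open>f\<close> but multiplies the coefficient by
  \<open>chi t w\<close>.\<close>

lemma F_inv_under:
  assumes "sg W" "inv_under W f" "t \<in> V" "t \<notin> ann W" shows "F f t = 0"
proof -
  obtain w where w: "w \<in> W" "dt t w \<noteq> 0"
    using assms by (auto simp: ann_def)
  then have "w \<in> V" using assms sg_sub by auto
  have "F f t = (\<Sum>x\<in>V. of_real (f (x \<oplus> w)) * chi t (x \<oplus> w))"
    unfolding F_def using sum_shift(1)[OF sg_V \<open>w \<in> V\<close>, of "\<lambda>x. of_real (f x) * chi t x"] by simp
  also have "\<dots> = F f t * chi t w"
    unfolding F_def sum_distrib_right
    by (intro sum.cong refl) (use assms w in \<open>simp add: inv_under_def chi_add\<close>)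
  finally show ?thesis
    using w chi_eq_1_iff by simp
qed

text \<open>A character in the annihilator is constant on cosets of \<open>W\<close>, so the
  coefficient is a combination of coset sums of \<open>f\<close>, all zero.\<close>

lemma F_mean_zero:
  assumes "sg W" "mean_zero W f" "t \<in> ann W" shows "F f t = 0"
proof -
  have "of_nat (card W) * F f t = (\<Sum>w\<in>W. \<Sum>x\<in>V. of_real (f (x \<oplus> w)) * chi t (x \<oplus> w))"
    using sum_shift(1)[OF sg_V, of _ "\<lambda>x. of_real (f x) * chi t x"] sg_sub[OF assms(1)]
    by (simp add: F_def subset_iff)
  also have "\<dots> = (\<Sum>w\<in>W. \<Sum>x\<in>V. of_real (f (x \<oplus> w)) * chi t x)"
    using assms chi_eq_1_iff by (intro sum.cong refl) (simp add: ann_def chi_add)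
  also have "\<dots> = (\<Sum>x\<in>V. of_real (\<Sum>w\<in>W. f (x \<oplus> w)) * chi t x)"
    by (subst sum.swap) (simp add: sum_distrib_right)
  also have "\<dots> = 0"
    using assms by (simp add: mean_zero_def)
  finally show ?thesis
    using sg_card_pos[OF assms(1)] by simp
qed

text \<open>Since \<open>p\<close> is an odd prime, -2 is invertible modulo
  \<open>p\<close>.\<close>

lemma ann_smul_iff:
  assumes "t \<in> V" shows "smul (p - 2) t \<in> ann W \<longleftrightarrow> t \<in> ann W"
proof -
  have "dt (smul (p - 2) t) w = 0 \<longleftrightarrow> dt t w = 0" for w
  proof -
    have "dt (smul (p - 2) t) w = 0 \<longleftrightarrow> p dvd (p - 2) * dt t w"
      using dt_smul[of w "p - 2" t] by (simp add: dt_comm mod_eq_0_iff_dvd)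
    also have "\<dots> \<longleftrightarrow> p dvd dt t w"
      using prime_p p_gt_2 by (auto simp: prime_dvd_mult_iff dest: dvd_imp_le)
    also have "\<dots> \<longleftrightarrow> dt t w = 0"
      using dt_less[of t w] by (auto dest: dvd_imp_le)
    finally show ?thesis .
  qed
  then show ?thesis
    using assms smul_closed by (simp add: ann_def)
qed

text \<open>In Fourier space invariant functions live on the annihilator of \<open>W\<close> and mean-zero functions
  off it, and the three frequencies \<open>t\<close>, \<open>-2t\<close>, \<open>t\<close> are either all in it or all outside.\<close>

lemma T_cross:
  assumes W: "sg W" and "inv_under W f \<or> inv_under W g \<or> inv_under W h"
    "mean_zero W f \<or> mean_zero W g \<or> mean_zero W h"
  shows "T f g h = 0"
proof -
  have "F f t * F g (smul (p - 2) t) * F h t = 0" if t: "t \<in> V" for t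
  proof (cases "t \<in> ann W")
    case True
    then show ?thesis
      using F_mean_zero[OF W] assms(3) ann_smul_iff[OF t] by (metis mult_eq_0_iff)
  next
    case False
    then show ?thesis
      using F_inv_under[OF W] assms(2) ann_smul_iff[OF t] smul_closed[OF t] t
      by (metis mult_eq_0_iff)
  qed
  then have "complex_of_real (real p ^ n * T f g h) = 0"
    unfolding T_fourier by (rule sum.neutral[OF ballI])
  then have "real p ^ n * T f g h = 0"
    by (simp only: of_real_eq_0_iff)
  then show ?thesis
    using p_gt_2 by simp
qed

lemma T_add1: "T (\<lambda>x. a x + b x) g h = T a g h + T b g h"
  and T_add2: "T f (\<lambda>x. a x + b x) h = T f a h + T f b h"
  and T_add3: "T f g (\<lambda>x. a x + b x) = T f g a + T f g b"
  by (simp_all add: T_def algebra_simps sum.distrib)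

lemma T_scale:
  "T (\<lambda>x. c * f x) (\<lambda>x. d * g x) (\<lambda>x. e * h x) = c * d * e * T f g h"
  by (simp add: T_def sum_distrib_left mult_ac)

lemma T_mono:
  assumes "\<And>x. x \<in> V \<Longrightarrow> 0 \<le> f x \<and> f x \<le> g x"
  shows "T f f f \<le> T g g g"
  unfolding T_def
proof (intro sum_mono)
  fix m d assume "m \<in> V" "d \<in> V"
  then have "0 \<le> f y \<and> f y \<le> g y" if "y \<in> {m, m \<oplus> d, m \<oplus> d \<oplus> d}" for y
    using assms that add_closed by auto
  then show "f m * f (m \<oplus> d) * f (m \<oplus> d \<oplus> d) \<le> g m * g (m \<oplus> d) * g (m \<oplus> d \<oplus> d)"
    by (intro mult_mono mult_nonneg_nonneg) (force intro: order_trans)+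
qed

text \<open>Of the eight terms of the expansion, the six mixed ones vanish by
  \<open>T_cross\<close>. This is applied to the indicator of \<open>S\<close>, to its perturbed
  average and inside Varnavides' argument.\<close>

lemma T_split:
  assumes "sg W" "inv_under W a" "mean_zero W b"
  shows "T (\<lambda>x. a x + b x) (\<lambda>x. a x + b x) (\<lambda>x. a x + b x) = T a a a + T b b b"
  unfolding T_add1 T_add2 T_add3 using T_cross[OF assms(1)] assms(2,3) by simp

text \<open>The outer factors share the frequency \<open>t\<close>, so bounding the middle one by
  \<open>B\<close> leaves a sum of squares for Parseval.\<close>

lemma T_bound:
  assumes "\<And>t. t \<in> V \<Longrightarrow> norm (F v t) \<le> B"
  shows "\<bar>T v v v\<bar> \<le> B * (\<Sum>x\<in>V. (v x)\<^sup>2)"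
proof -
  have "real p ^ n * \<bar>T v v v\<bar> = norm (complex_of_real (real p ^ n * T v v v))"
    by (simp add: abs_mult norm_mult norm_power)
  also have "\<dots> \<le> (\<Sum>t\<in>V. norm (F v t * F v (smul (p - 2) t) * F v t))"
    unfolding T_fourier by (rule norm_sum)
  also have "\<dots> \<le> (\<Sum>t\<in>V. B * (norm (F v t))\<^sup>2)"
  proof (rule sum_mono)
    fix t assume "t \<in> V"
    then have "norm (F v (smul (p - 2) t)) * (norm (F v t))\<^sup>2 \<le> B * (norm (F v t))\<^sup>2"
      using assms smul_closed by (intro mult_right_mono) auto
    then show "norm (F v t * F v (smul (p - 2) t) * F v t) \<le> B * (norm (F v t))\<^sup>2"
      by (simp add: norm_mult power2_eq_square mult_ac)
  qed
  also have "\<dots> = real p ^ n * (B * (\<Sum>x\<in>V. (v x)\<^sup>2))"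
    by (simp add: sum_distrib_left[symmetric] parseval)
  finally show ?thesis
    using p_pos by simp
qed

definition avg :: "(nat \<Rightarrow> nat) set \<Rightarrow> ((nat \<Rightarrow> nat) \<Rightarrow> real) \<Rightarrow> (nat \<Rightarrow> nat) \<Rightarrow> real" where
  "avg W f x = (\<Sum>w\<in>W. f (x \<oplus> w)) / card W"

lemma avg_inv_under: "sg W \<Longrightarrow> inv_under W (avg W f)"
  unfolding inv_under_def avg_def using sum_shift(2)[of W _ "\<lambda>w. f (_ \<oplus> w)"]
  by (simp add: add_assoc)

lemma mean_zero_diff_avg:
  assumes "sg W" shows "mean_zero W (\<lambda>x. f x - avg W f x)"
  unfolding mean_zero_def
proof
  fix x assume "x \<in> V"
  then have "(\<Sum>w\<in>W. avg W f (x \<oplus> w)) = card W * avg W f x"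
    using avg_inv_under[OF assms, of f] by (simp add: inv_under_def)
  then show "(\<Sum>w\<in>W. f (x \<oplus> w) - avg W f (x \<oplus> w)) = 0"
    using sg_card_pos[OF assms] by (simp add: sum_subtractf avg_def)
qed

lemma avg_bounds:
  assumes "sg W" "\<And>x. x \<in> V \<Longrightarrow> 0 \<le> f x \<and> f x \<le> 1" "x \<in> V"
  shows "0 \<le> avg W f x" "avg W f x \<le> 1"
proof -
  have *: "0 \<le> f (x \<oplus> w) \<and> f (x \<oplus> w) \<le> 1" if "w \<in> W" for w
    using assms that add_closed sg_sub by blast
  then show "0 \<le> avg W f x"
    by (simp add: avg_def sum_nonneg)
  have "(\<Sum>w\<in>W. f (x \<oplus> w)) \<le> (\<Sum>w\<in>W. 1)"
    using * by (intro sum_mono) auto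
  then show "avg W f x \<le> 1"
    using sg_card_pos[OF assms(1)] by (simp add: avg_def)
qed

text \<open>Averaging is self-adjoint and fixes invariant functions, so an indicator may be replaced
  by its average in any sum against an invariant weight.\<close>

lemma sum_avg:
  assumes "sg W" "inv_under W b"
  shows "(\<Sum>x\<in>V. avg W f x * b x) = (\<Sum>x\<in>V. f x * b x)"
proof -
  have "card W * (avg W f x * b x) = (\<Sum>w\<in>W. f (x \<oplus> w) * b x)" for x
    using sg_card_pos[OF assms(1)] by (simp add: avg_def sum_distrib_right[symmetric])
  then have "card W * (\<Sum>x\<in>V. avg W f x * b x) = (\<Sum>x\<in>V. \<Sum>w\<in>W. f (x \<oplus> w) * b x)"
    by (simp add: sum_distrib_left)
  also have "\<dots> = (\<Sum>w\<in>W. \<Sum>x\<in>V. f (x \<oplus> w) * b (x \<oplus> w))"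
    by (subst sum.swap, intro sum.cong refl) (use assms in \<open>simp add: inv_under_def\<close>)
  also have "\<dots> = card W * (\<Sum>x\<in>V. f x * b x)"
    using sum_shift(1)[OF sg_V, of _ "\<lambda>x. f x * b x"] sg_sub[OF assms(1)]
    by (simp add: subset_iff)
  finally show ?thesis
    using sg_card_pos[OF assms(1)] by simp
qed

lemma sum_mean_zero:
  assumes "sg W" "mean_zero W b" shows "(\<Sum>x\<in>V. b x) = 0"
  using sum_avg[of W "\<lambda>_. 1" b] assms by (simp add: avg_def mean_zero_def inv_under_def)

lemma F_avg:
  assumes "sg W" "t \<in> V" shows "F (avg W f) t = (if t \<in> ann W then F f t else 0)"
proof (cases "t \<in> ann W")
  case True
  have "F f t - F (avg W f) t = F (\<lambda>x. f x - avg W f x) t"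
    by (simp add: F_def sum_subtractf[symmetric] left_diff_distrib)
  then show ?thesis
    using F_mean_zero[OF assms(1) mean_zero_diff_avg[OF assms(1)] True, of f] True by simp
next
  case False
  then show ?thesis using F_inv_under[OF assms(1) avg_inv_under assms(2)] assms by simp
qed

section \<open>Hyperplane sections of a subgroup and the energy of averages\<close>

text \<open>Translation by \<open>w0\<close> injects each fibre into the one whose value is larger
  by \<open>dt t w0\<close> modulo \<open>p\<close>. That value generates all residues, so the
  \<open>p\<close> fibres are equally large.\<close>

lemma fibre_card:
  assumes W: "sg W" and w0: "w0 \<in> W" "dt t w0 \<noteq> 0" and j: "j < p"
  shows "p * card {w\<in>W. dt t w = j} = card W"
proof -
  define N where "N i = card {w\<in>W. dt t w = i mod p}" for i
  have step: "N i \<le> N (i + dt t w0)" for i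
    unfolding N_def
  proof (rule card_inj_on_le)
    show "inj_on (\<lambda>w. w \<oplus> w0) {w\<in>W. dt t w = i mod p}"
      using bij_shift[OF W w0(1)] by (auto simp: bij_betw_def intro: inj_on_subset)
    show "(\<lambda>w. w \<oplus> w0) ` {w\<in>W. dt t w = i mod p} \<subseteq> {w\<in>W. dt t w = (i + dt t w0) mod p}"
      using W w0 sg_add by (auto simp: dt_add mod_simps)
  qed (use sg_finite[OF W] in simp)
  have steps: "N i \<le> N (i + k * dt t w0)" for i k
  proof (induction k)
    case (Suc k)
    then show ?case using step[of "i + k * dt t w0"] by (simp add: add_ac)
  qed simp
  have "coprime (dt t w0) p"
    using prime_p w0 dt_less[of t w0] prime_imp_coprime
    by (metis coprime_commute dvd_imp_le not_gr_zero not_le)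
  then obtain u where "[dt t w0 * u = 1] (mod p)"
    using cong_solve_coprime_nat by auto
  then have u: "[k * u * dt t w0 = k] (mod p)" for k
    by (metis (no_types, lifting) cong_scalar_left mult.assoc mult.commute mult.right_neutral)
  have le: "N i \<le> N i'" if "i < p" for i i'
  proof -
    \<comment> \<open>\<open>u\<close> inverts \<open>dt t w0\<close> modulo \<open>p\<close>, and
      \<open>p - i + i'\<close> represents i' - i in the naturals, so
      \<open>(p - i + i') * u\<close> translations lead from residue \<open>i\<close> to
      \<open>i'\<close>.\<close>
    have "[i + (p - i + i') * u * dt t w0 = i + (p - i + i')] (mod p)"
      by (intro cong_add u cong_refl)
    also have "i + (p - i + i') = p + i'" using that by simp
    finally have "N (i + (p - i + i') * u * dt t w0) = N i'"
      by (simp add: N_def cong_def)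
    then show ?thesis using steps by metis
  qed
  have "card W = (\<Sum>i<p. card {w\<in>W. dt t w = i})"
    using sg_finite[OF W] dt_less
    by (subst card_UN_disjoint[symmetric]) (auto intro!: arg_cong[where f = card])
  also have "\<dots> = (\<Sum>i<p. N j)"
  proof (rule sum.cong)
    fix i assume "i \<in> {..<p}"
    then show "card {w\<in>W. dt t w = i} = N j"
      using le[of i j] le[of j i] j by (simp add: N_def)
  qed simp
  finally show ?thesis using j by (simp add: N_def)
qed

lemma sg_ker: "sg W \<Longrightarrow> sg {w\<in>W. dt t w = 0}"
  unfolding is_subgroup_def
proof (intro conjI ballI)
  fix x assume W: "W \<subseteq> V \<and> vzero \<in> W \<and> (\<forall>x\<in>W. \<forall>y\<in>W. x \<oplus> y \<in> W) \<and> (\<forall>x\<in>W. \<exists>y\<in>W. x \<oplus> y = vzero)"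
    and x: "x \<in> {w \<in> W. dt t w = 0}"
  then have "smul (p - Suc 0) x \<in> W"
    using sg_neg[of W x] by (simp add: is_subgroup_def)
  then show "\<exists>y\<in>{w \<in> W. dt t w = 0}. x \<oplus> y = vzero"
    using x by (intro bexI[of _ "smul (p - Suc 0) x"]) (auto simp: add_neg dt_smul)
qed (auto simp: dt_zero dt_add)

text \<open>Averaging truncates the Fourier transform to the annihilator, and Parseval turns this
  into energy.\<close>

lemma energy_eq:
  assumes "sg W"
  shows "real p ^ n * (\<Sum>x\<in>V. (avg W f x)\<^sup>2) = (\<Sum>t\<in>ann W. (norm (F f t))\<^sup>2)"
proof -
  have "(\<Sum>t\<in>V. (norm (F (avg W f) t))\<^sup>2) = (\<Sum>t\<in>V. if t \<in> ann W then (norm (F f t))\<^sup>2 else 0)"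
    by (intro sum.cong refl) (simp add: F_avg[OF assms])
  also have "\<dots> = (\<Sum>t\<in>ann W. (norm (F f t))\<^sup>2)"
    by (rule sum.mono_neutral_cong_right) (auto simp: ann_def)
  finally show ?thesis by (simp add: parseval)
qed

text \<open>Instead of iterating an energy increment, take a subgroup maximising energy plus a multiple
  of the dimension: comparison with the whole space bounds its codimension, comparison with its
  hyperplanes bounds the Fourier coefficients.\<close>

lemma regular_subgroup:
  assumes f: "\<And>x. x \<in> V \<Longrightarrow> 0 \<le> f x \<and> f x \<le> 1" and "\<eta> > 0"
  obtains W where "sg W" "real n - 1 / \<eta> \<le> real (sub_dim p W)"
    "\<And>t. t \<in> V \<Longrightarrow> norm (F (\<lambda>x. f x - avg W f x) t) \<le> sqrt \<eta> * real p ^ n"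
proof -
  define en where "en W = (\<Sum>x\<in>V. (avg W f x)\<^sup>2) / real p ^ n" for W
  have en_sq: "en W * (real p ^ n)\<^sup>2 = real p ^ n * (\<Sum>x\<in>V. (avg W f x)\<^sup>2)" for W
    using p_gt_2 by (simp add: en_def power2_eq_square)
  define pot where "pot W = en W + \<eta> * real (sub_dim p W)" for W
  have fin: "finite {W. sg W}"
    by (rule finite_subset[of _ "Pow V"]) (auto dest: sg_sub)
  have "Max (pot ` {W. sg W}) \<in> pot ` {W. sg W}"
    using fin sg_V by (intro Max_in) auto
  then obtain W where W: "sg W" "pot W = Max (pot ` {W. sg W})" by auto
  have max: "pot U \<le> pot W" if "sg U" for U
    using that fin W by simp
  have "(\<Sum>x\<in>V. (avg W f x)\<^sup>2) \<le> (\<Sum>x\<in>V. 1)"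
    by (intro sum_mono power_le_one) (use avg_bounds[OF W(1) f] in auto)
  then have "en W \<le> 1" by (simp add: en_def card_V)
  moreover have "\<eta> * real n \<le> pot V"
    using sub_dim_eqI[OF card_V] by (simp add: pot_def en_def sum_nonneg)
  ultimately have "\<eta> * real n \<le> 1 + \<eta> * real (sub_dim p W)"
    using max[OF sg_V] by (simp add: pot_def)
  then have dim: "real n - 1 / \<eta> \<le> real (sub_dim p W)"
    using \<open>\<eta> > 0\<close> by (simp add: field_simps)
  have "norm (F (\<lambda>x. f x - avg W f x) t) \<le> sqrt \<eta> * real p ^ n" if t: "t \<in> V" for t
  proof (cases "t \<in> ann W")
    case True
    then show ?thesis
      using F_mean_zero[OF W(1) mean_zero_diff_avg[OF W(1)] True, of f] \<open>\<eta> > 0\<close> by simp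
  next
    case False
    have "F (\<lambda>x. f x - avg W f x) t = F f t - F (avg W f) t"
      by (simp add: F_def sum_subtractf[symmetric] left_diff_distrib)
    then have Ft: "F (\<lambda>x. f x - avg W f x) t = F f t"
      using F_avg[OF W(1) t] False by simp
    define H where "H = {w\<in>W. dt t w = 0}"
    have H: "sg H" using sg_ker W by (simp add: H_def)
    obtain w0 where "w0 \<in> W" "dt t w0 \<noteq> 0"
      using False t by (auto simp: ann_def)
    then have "p * card H = card W"
      using fibre_card[OF W(1), of w0 t 0] by (simp add: H_def)
    then have "card W = p ^ Suc (sub_dim p H)"
      using card_sg[OF H] by simp
    then have "sub_dim p W = Suc (sub_dim p H)"
      by (rule sub_dim_eqI)
    then have en: "en H - en W \<le> \<eta>"
      using max[OF H] by (simp add: pot_def algebra_simps)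
    \<comment> \<open>\<open>t\<close> annihilates \<open>H\<close> but not \<open>W\<close>, so its
      coefficient is part of the energy gained on passing to \<open>H\<close>; only one dimension is
      lost, so that gain is at most \<eta>.\<close>
    have "(\<Sum>s\<in>ann W. (norm (F f s))\<^sup>2) + (norm (F f t))\<^sup>2 =
        (\<Sum>s\<in>insert t (ann W). (norm (F f s))\<^sup>2)"
      using False finite_subset[OF _ finite_V, of "ann W"] by (subst sum.insert) (auto simp: ann_def)
    also have "\<dots> \<le> (\<Sum>s\<in>ann H. (norm (F f s))\<^sup>2)"
      using t finite_subset[OF _ finite_V, of "ann H"] by (intro sum_mono2) (auto simp: ann_def H_def)
    finally have "(norm (F f t))\<^sup>2 \<le> (en H - en W) * (real p ^ n)\<^sup>2"
      using energy_eq[OF H, of f] energy_eq[OF W(1), of f] en_sq[of H] en_sq[of W]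
      by (simp add: left_diff_distrib)
    also have "\<dots> \<le> \<eta> * (real p ^ n)\<^sup>2"
      using en by (intro mult_right_mono) auto
    finally have "sqrt ((norm (F f t))\<^sup>2) \<le> sqrt (\<eta> * (real p ^ n)\<^sup>2)"
      by (rule real_sqrt_le_mono)
    then show ?thesis
      by (simp add: Ft real_sqrt_mult)
  qed
  then show thesis using that W dim by blast
qed

subsection \<open>Varnavides' theorem\<close>

lemma sum_indicator_V:
  assumes "B \<subseteq> V" shows "(\<Sum>x\<in>V. indicator B x) = real (card B)"
proof -
  have "(\<Sum>x\<in>V. indicator B x) = (\<Sum>x\<in>B. 1 :: real)"
    using assms by (intro sum.mono_neutral_cong_right) auto
  then show ?thesis by simp
qed

lemma T_indicator_sg:
  assumes "sg W" shows "T (indicator W) (indicator W) (indicator W) = (real (card W))\<^sup>2"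
proof -
  let ?i = "indicator W :: _ \<Rightarrow> real"
  have mem: "m \<oplus> d \<in> W \<longleftrightarrow> d \<in> W" if "m \<in> W" "d \<in> V" for m d
    using sg_mem_iff[OF assms, of d m] that add_comm by metis
  have "?i m * ?i (m \<oplus> d) * ?i (m \<oplus> d \<oplus> d) = ?i m * ?i d" if "m \<in> V" "d \<in> V" for m d
    using mem[of m d] mem[of "m \<oplus> d" d] that by (auto simp: indicator_def)
  then have "T ?i ?i ?i = (\<Sum>m\<in>V. \<Sum>d\<in>V. ?i m * ?i d)"
    unfolding T_def by (intro sum.cong refl)
  also have "\<dots> = (real (card W))\<^sup>2"
    unfolding sum_product[symmetric] sum_indicator_V[OF sg_sub[OF assms]]
    by (simp add: power2_eq_square)
  finally show ?thesis .
qed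

lemma T_shift:
  assumes "a \<in> V" shows "T (\<lambda>x. f (x \<oplus> a)) (\<lambda>x. f (x \<oplus> a)) (\<lambda>x. f (x \<oplus> a)) = T f f f"
proof -
  let ?k = "\<lambda>m. \<Sum>d\<in>V. f m * f (m \<oplus> d) * f (m \<oplus> d \<oplus> d)"
  have "m \<oplus> d \<oplus> a = m \<oplus> a \<oplus> d" for m d
    using add_assoc add_comm by metis
  then have "T (\<lambda>x. f (x \<oplus> a)) (\<lambda>x. f (x \<oplus> a)) (\<lambda>x. f (x \<oplus> a)) = (\<Sum>m\<in>V. ?k (m \<oplus> a))"
    by (simp add: T_def)
  also have "\<dots> = T f f f"
    unfolding T_def by (rule sum_shift(1)[where k = ?k, OF sg_V assms])
  finally show ?thesis .
qed

text \<open>A large Fourier coefficient of \<open>f\<close> minus its mean makes \<open>f\<close> denser on a coset of a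
  hyperplane; \<open>k\<close> bounds the number of such increments that are still possible.\<close>

lemma varnavides_aux:
  assumes "0 < \<epsilon>0" "\<epsilon>0 \<le> \<epsilon>" "1 < \<epsilon> + real k * (\<epsilon>0 ^ 3 / 4)" "sg W"
    "\<And>x. x \<in> V \<Longrightarrow> 0 \<le> f x \<and> f x \<le> 1" "\<And>x. x \<in> V \<Longrightarrow> x \<notin> W \<Longrightarrow> f x = 0"
    "\<epsilon> * real (card W) \<le> (\<Sum>x\<in>V. f x)"
  shows "\<epsilon>0 ^ 3 / 2 / (real p ^ 2) ^ k * (real (card W))\<^sup>2 \<le> T f f f"
  using assms(2-)
proof (induction k arbitrary: \<epsilon> W f)
  case (0 \<epsilon> W f)
  \<comment> \<open>With no increment left the density would exceed 1: this case is
    contradictory.\<close>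
  have "(\<Sum>x\<in>V. f x) \<le> (\<Sum>x\<in>V. indicator W x)"
    using 0 by (intro sum_mono) (auto simp: indicator_def)
  also have "\<dots> = real (card W)"
    by (rule sum_indicator_V[OF sg_sub[OF 0(3)]])
  also have "\<dots> < \<epsilon> * real (card W)"
    using 0 sg_card_pos by simp
  finally show ?case using 0 by simp
next
  case (Suc k \<epsilon> W f)
  note W = Suc.prems(3) and f = Suc.prems(4) and fW = Suc.prems(5)
  define N where "N = real (card W)"
  have N: "N > 0" using sg_card_pos[OF W] by (simp add: N_def)
  define \<sigma> where "\<sigma> = (\<Sum>x\<in>V. f x) / N"
  define a where "a = (\<lambda>x. \<sigma> * indicator W x)"
  define b where "b = (\<lambda>x. f x - a x)"
  have sumW: "(\<Sum>x\<in>V. indicator W x) = N"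
    unfolding N_def by (rule sum_indicator_V[OF sg_sub[OF W]])
  have \<sigma>: "\<epsilon> \<le> \<sigma>"
    using Suc.prems N by (simp add: \<sigma>_def N_def field_simps)
  have "(\<Sum>x\<in>V. f x) \<le> (\<Sum>x\<in>V. indicator W x)"
    using f fW by (intro sum_mono) (auto simp: indicator_def)
  then have \<sigma>1: "\<sigma> \<le> 1" using sumW N by (simp add: \<sigma>_def)
  have \<epsilon>: "0 < \<epsilon>" using assms(1) Suc.prems by simp
  have b0: "b x = 0" if "x \<in> V" "x \<notin> W" for x
    using that fW by (simp add: b_def a_def)
  have sum_b: "(\<Sum>x\<in>W. b x) = 0"
  proof -
    have "(\<Sum>x\<in>W. b x) = (\<Sum>x\<in>V. b x)"
      using b0 sg_sub[OF W] by (intro sum.mono_neutral_left) auto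
    also have "\<dots> = (\<Sum>x\<in>V. f x) - \<sigma> * N"
      unfolding b_def a_def sum_subtractf sum_distrib_left[symmetric] sumW ..
    also have "\<dots> = 0"
      using N by (simp add: \<sigma>_def)
    finally show ?thesis .
  qed
  have inv_a: "inv_under W a"
    unfolding inv_under_def a_def using sg_mem_iff[OF W] by (auto simp: indicator_def)
  have mz_b: "mean_zero W b"
    unfolding mean_zero_def
  proof
    fix x assume x: "x \<in> V"
    show "(\<Sum>w\<in>W. b (x \<oplus> w)) = 0"
    proof (cases "x \<in> W")
      case True
      then show ?thesis using sum_shift(2)[OF W True, of b] sum_b by simp
    next
      case False
      have "b (x \<oplus> w) = 0" if "w \<in> W" for w
        using that x False sg_mem_iff[OF W x] add_closed sg_sub[OF W] by (intro b0) auto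
      then show ?thesis by simp
    qed
  qed
  have "T f f f = T (\<lambda>x. a x + b x) (\<lambda>x. a x + b x) (\<lambda>x. a x + b x)"
    by (simp add: b_def)
  also have "\<dots> = \<sigma> ^ 3 * N\<^sup>2 + T b b b"
    unfolding T_split[OF W inv_a mz_b] unfolding a_def T_scale T_indicator_sg[OF W]
    by (simp add: N_def power3_eq_cube)
  finally have Tf: "T f f f = \<sigma> ^ 3 * N\<^sup>2 + T b b b" .
  show ?case
  proof (cases "\<forall>t\<in>V. norm (F b t) \<le> \<epsilon>0 ^ 3 / 2 * N")
    case True
    \<comment> \<open>Small coefficients keep the error term at most half of the main term, as the
      density \<sigma> is at least \<open>\<epsilon>0\<close>.\<close>
    have "\<bar>b x\<bar> \<le> indicator W x" if "x \<in> V" for x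
      using f[OF that] b0[OF that] \<sigma> \<sigma>1 \<epsilon> by (auto simp: b_def a_def indicator_def)
    then have "(b x)\<^sup>2 \<le> indicator W x" if "x \<in> V" for x
      using that abs_square_le_1[of "b x"] by (fastforce simp: indicator_def split: if_splits)
    then have "(\<Sum>x\<in>V. (b x)\<^sup>2) \<le> N"
      unfolding sumW[symmetric] by (intro sum_mono)
    then have "\<epsilon>0 ^ 3 / 2 * N * (\<Sum>x\<in>V. (b x)\<^sup>2) \<le> \<epsilon>0 ^ 3 / 2 * N * N"
      using N assms(1) by (intro mult_left_mono) auto
    then have "\<bar>T b b b\<bar> \<le> \<epsilon>0 ^ 3 / 2 * N\<^sup>2"
      using T_bound[of b "\<epsilon>0 ^ 3 / 2 * N"] True by (simp add: power2_eq_square mult.assoc)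
    moreover have "\<epsilon>0 ^ 3 * N\<^sup>2 \<le> \<sigma> ^ 3 * N\<^sup>2"
      using \<sigma> Suc.prems assms(1) by (intro mult_right_mono power_mono) auto
    ultimately have "\<epsilon>0 ^ 3 / 2 * N\<^sup>2 \<le> T f f f"
      unfolding Tf by linarith
    moreover have "\<epsilon>0 ^ 3 / 2 / (real p ^ 2) ^ Suc k * N\<^sup>2 \<le> \<epsilon>0 ^ 3 / 2 * N\<^sup>2"
    proof -
      have "1 \<le> (real p ^ 2) ^ Suc k"
        using p_gt_2 by (intro one_le_power) auto
      then have "\<epsilon>0 ^ 3 / 2 / (real p ^ 2) ^ Suc k \<le> \<epsilon>0 ^ 3 / 2 / 1"
        using assms(1) by (intro divide_left_mono) auto
      then show ?thesis by (intro mult_right_mono) auto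
    qed
    ultimately show ?thesis by (simp add: N_def)
  next
    case False
    then obtain t where t: "t \<in> V" "norm (F b t) > \<epsilon>0 ^ 3 / 2 * N" by auto
    have "t \<notin> ann W"
    proof
      assume "t \<in> ann W"
      then have "norm (F b t) = 0" using F_mean_zero[OF W mz_b] by simp
      moreover have "0 < \<epsilon>0 ^ 3 / 2 * N" using assms(1) N by simp
      ultimately show False using t by linarith
    qed
    then obtain w0 where w0: "w0 \<in> W" "dt t w0 \<noteq> 0"
      using t by (auto simp: ann_def)
    define K where "K j = {w\<in>W. dt t w = j}" for j
    define H where "H = K 0"
    have H: "sg H" using sg_ker[OF W] by (simp add: H_def K_def)
    have cardK: "real p * real (card (K j)) = N" if "j < p" for j
      using fibre_card[OF W w0 that] by (simp add: K_def N_def flip: of_nat_mult)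
    have sumK: "(\<Sum>x\<in>W. g x) = (\<Sum>j<p. \<Sum>x\<in>K j. g x)" for g :: "(nat \<Rightarrow> nat) \<Rightarrow> 'b :: comm_monoid_add"
      unfolding K_def using sg_finite[OF W] dt_less by (intro sum.group[symmetric]) auto
    have "F b t = (\<Sum>x\<in>W. of_real (b x) * chi t x)"
      unfolding F_def using b0 sg_sub[OF W] by (intro sum.mono_neutral_right) auto
    also have "\<dots> = (\<Sum>j<p. of_real (\<Sum>x\<in>K j. b x) * cis (2 * pi * real j / real p))"
      unfolding sumK by (simp add: sum_distrib_right K_def chi_def)
    finally have "norm (F b t) \<le> (\<Sum>j<p. norm (of_real (\<Sum>x\<in>K j. b x) * cis (2 * pi * real j / real p)))"
      using norm_sum by metis
    then have Fb: "norm (F b t) \<le> (\<Sum>j<p. \<bar>\<Sum>x\<in>K j. b x\<bar>)"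
      by (simp add: norm_mult del: of_real_sum)
    \<comment> \<open>The fibre sums of \<open>b\<close> add up to zero while their absolute values
      exceed \<open>\<epsilon>0 ^ 3 / 2 * N\<close> in total. Half of this is positive mass, and
      some fibre gets at least a \<open>p\<close>-th of that half.\<close>
    have "\<exists>j<p. \<epsilon>0 ^ 3 / 4 * N / p \<le> (\<Sum>x\<in>K j. b x)"
    proof (rule ccontr)
      assume neg: "\<not> ?thesis"
      have "\<bar>\<Sum>x\<in>K j. b x\<bar> \<le> 2 * (\<epsilon>0 ^ 3 / 4 * N / p) - (\<Sum>x\<in>K j. b x)" if "j < p" for j
      proof -
        have "(\<Sum>x\<in>K j. b x) < \<epsilon>0 ^ 3 / 4 * N / p"
          using neg that by (meson not_le)
        moreover have "0 \<le> \<epsilon>0 ^ 3 / 4 * N / p"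
          using assms(1) N by simp
        ultimately show ?thesis by linarith
      qed
      then have "(\<Sum>j<p. \<bar>\<Sum>x\<in>K j. b x\<bar>) \<le> (\<Sum>j<p. 2 * (\<epsilon>0 ^ 3 / 4 * N / p) - (\<Sum>x\<in>K j. b x))"
        by (intro sum_mono) auto
      also have "\<dots> = \<epsilon>0 ^ 3 / 2 * N"
        using p_gt_2 sum_b by (simp add: sum_subtractf sumK[symmetric])
      finally show False using Fb t by linarith
    qed
    then obtain j where j: "j < p" "\<epsilon>0 ^ 3 / 4 * N / p \<le> (\<Sum>x\<in>K j. b x)" by auto
    have cK: "real (card (K j)) = N / p" "real (card H) = N / p"
      using cardK[OF j(1)] cardK[of 0] p_gt_2 by (auto simp: H_def field_simps)
    then have "K j \<noteq> {}" using N p_gt_2 by auto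
    then obtain c where c: "c \<in> W" "dt t c = j" by (auto simp: K_def)
    then have "c \<in> V" using sg_sub[OF W] by auto
    have KH: "x \<oplus> c \<in> K j \<longleftrightarrow> x \<in> H" if "x \<in> V" for x
    proof -
      have "(dt t x + j) mod p = j \<longleftrightarrow> dt t x = 0"
        using dt_less[of t x] j(1) by (cases "dt t x + j < p") (auto simp: mod_if)
      then show ?thesis
        using sg_mem_iff[OF W that c(1)] c by (simp add: K_def H_def dt_add)
    qed
    \<comment> \<open>The fibre is translated onto the subgroup \<open>H\<close> so that the
      induction hypothesis applies. As |H| = |W|/p, each increment costs a factor p^2 in the
      bound.\<close>
    define g where "g = (\<lambda>x. indicator H x * f (x \<oplus> c))"
    have "(\<epsilon> + \<epsilon>0 ^ 3 / 4) * real (card H) \<le> \<epsilon>0 ^ 3 / 4 * N / p + \<sigma> * real (card (K j))"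
      using \<sigma> N p_gt_2 by (simp add: cK field_simps)
    also have "\<dots> \<le> (\<Sum>x\<in>K j. b x) + (\<Sum>x\<in>K j. a x)"
      using j(2) by (simp add: a_def K_def)
    also have "\<dots> = (\<Sum>x\<in>K j. f x)"
      by (simp add: b_def sum.distrib[symmetric])
    also have "\<dots> = (\<Sum>x\<in>V. indicator (K j) x * f x)"
      using sg_sub[OF W] by (intro sum.mono_neutral_cong_left) (auto simp: K_def)
    also have "\<dots> = (\<Sum>x\<in>V. indicator (K j) (x \<oplus> c) * f (x \<oplus> c))"
      by (rule sum_shift(1)[OF sg_V \<open>c \<in> V\<close>, symmetric])
    also have "\<dots> = (\<Sum>x\<in>V. g x)"
      by (intro sum.cong refl) (simp add: g_def KH indicator_def)
    finally have sum_g: "(\<epsilon> + \<epsilon>0 ^ 3 / 4) * real (card H) \<le> (\<Sum>x\<in>V. g x)" .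
    have "\<epsilon>0 ^ 3 / 2 / (real p ^ 2) ^ k * (real (card H))\<^sup>2 \<le> T g g g"
    proof (rule Suc.IH[OF _ _ H _ _ sum_g])
      show "\<epsilon>0 \<le> \<epsilon> + \<epsilon>0 ^ 3 / 4" using Suc.prems assms(1) by (simp add: add_increasing2)
      show "1 < \<epsilon> + \<epsilon>0 ^ 3 / 4 + real k * (\<epsilon>0 ^ 3 / 4)"
        using Suc.prems by (simp add: algebra_simps add_divide_distrib)
      show "0 \<le> g x \<and> g x \<le> 1" if "x \<in> V" for x
        using f add_closed that \<open>c \<in> V\<close> by (simp add: g_def indicator_def)
      show "g x = 0" if "x \<notin> H" for x
        using that by (simp add: g_def)
    qed
    also have "T g g g \<le> T (\<lambda>x. f (x \<oplus> c)) (\<lambda>x. f (x \<oplus> c)) (\<lambda>x. f (x \<oplus> c))"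
      by (rule T_mono) (use f add_closed \<open>c \<in> V\<close> in \<open>auto simp: g_def indicator_def\<close>)
    also have "\<dots> = T f f f" by (rule T_shift[OF \<open>c \<in> V\<close>])
    finally show ?thesis
      by (simp add: cK N_def power_divide mult_ac)
  qed
qed

subsection \<open>Rounding to sets\<close>

text \<open>Constant progressions are left out: they contribute cubes, which are convex, whereas
  rounding exploits concavity of products over distinct points.\<close>

definition Q :: "((nat \<Rightarrow> nat) \<Rightarrow> real) \<Rightarrow> real" where
  "Q h = (\<Sum>m\<in>V. \<Sum>d\<in>V - {vzero}. h m * h (m \<oplus> d) * h (m \<oplus> d \<oplus> d))"

lemma T_eq_Q: "T h h h = Q h + (\<Sum>x\<in>V. h x ^ 3)"
proof -
  have "(\<Sum>d\<in>V. h m * h (m \<oplus> d) * h (m \<oplus> d \<oplus> d)) =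
      h m ^ 3 + (\<Sum>d\<in>V - {vzero}. h m * h (m \<oplus> d) * h (m \<oplus> d \<oplus> d))" if "m \<in> V" for m
    using that by (subst sum.remove[of _ vzero]) (auto simp: add_zero power3_eq_cube)
  then show ?thesis
    by (simp add: T_def Q_def sum.distrib)
qed

text \<open>Cancellation reduces the claims to d and 2d being nonzero; the latter uses that
  \<open>p\<close> is odd.\<close>

lemma progression_distinct:
  assumes "m \<in> V" "d \<in> V" "d \<noteq> vzero"
  shows "m \<noteq> m \<oplus> d" "m \<noteq> m \<oplus> d \<oplus> d" "m \<oplus> d \<noteq> m \<oplus> d \<oplus> d"
proof -
  have *: "y = vzero" if "x \<in> V" "y \<in> V" "x = x \<oplus> y" for x y
    using that add_cancel[of vzero y x] add_zero add_comm vzero_in by metis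
  show "m \<noteq> m \<oplus> d" "m \<oplus> d \<noteq> m \<oplus> d \<oplus> d"
    using *[of m d] *[of "m \<oplus> d" d] assms add_closed by auto
  show "m \<noteq> m \<oplus> d \<oplus> d"
  proof
    assume "m = m \<oplus> d \<oplus> d"
    then have dd: "d \<oplus> d = vzero"
      using *[of m "d \<oplus> d"] assms add_closed by (simp add: add_assoc)
    have "d i = 0" for i
    proof -
      have "p dvd 2 * d i"
        using fun_cong[OF dd, of i] by (simp add: vadd_def vzero_def mod_eq_0_iff_dvd mult_2)
      then have "p dvd d i"
        using prime_p p_gt_2 by (auto simp: prime_dvd_mult_iff dest: dvd_imp_le)
      moreover have "d i < p"
        using assms(2) by (cases "i < n") (auto simp: Vsp_def)
      ultimately show ?thesis by (auto dest: dvd_imp_le)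
    qed
    then show False using assms(3) by (auto simp: vzero_def)
  qed
qed

text \<open>Moving mass between two points \<open>x\<close>, \<open>y\<close> changes a product over distinct points
  concavely, so one of the two extreme moves does not increase the sum of all such products.\<close>

lemma exchange:
  fixes h :: "'a \<Rightarrow> real"
  assumes "a \<noteq> b" "a \<noteq> c" "b \<noteq> c" "x \<noteq> y" "0 \<le> l" "0 \<le> r" "0 \<le> h a" "0 \<le> h b" "0 \<le> h c"
  defines "h1 \<equiv> h(x := h x - l, y := h y + l)" and "h2 \<equiv> h(x := h x + r, y := h y - r)"
  shows "r * (h1 a * h1 b * h1 c) + l * (h2 a * h2 b * h2 c) \<le> (l + r) * (h a * h b * h c)"
proof -
  \<comment> \<open>The weights \<open>r\<close> and \<open>l\<close> balance the two moves:
    first-order terms cancel, and the difference is \<open>r * l * (l + r) * u\<close>.\<close>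
  have two: "r * ((h x - l) * ((h y + l) * u)) + l * ((h x + r) * ((h y - r) * u))
      \<le> (l + r) * (h x * (h y * u))" if "0 \<le> u" for u
  proof -
    have "(l + r) * (h x * (h y * u)) -
        (r * ((h x - l) * ((h y + l) * u)) + l * ((h x + r) * ((h y - r) * u))) = r * l * (l + r) * u"
      by (simp add: algebra_simps)
    then show ?thesis
      using assms that by (metis diff_ge_0_iff_ge mult_nonneg_nonneg add_nonneg_nonneg)
  qed
  show ?thesis
    unfolding h1_def h2_def using assms(1-4) assms(7-9)
    by (cases "a = x"; cases "b = x"; cases "c = x"; cases "a = y"; cases "b = y"; cases "c = y")
      (use two[of "h a"] two[of "h b"] two[of "h c"] in \<open>simp_all add: algebra_simps\<close>)
qed

text \<open>Induction on the number of values strictly between 0 and 1. Between two such points,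
  \<open>l\<close> and \<open>r\<close> are the largest moves that stay in [0,1]; each makes one of
  the two values 0 or 1, and by \<open>exchange\<close> one of them does not increase
  \<open>Q\<close>.\<close>

lemma round_all_but_one:
  assumes "\<And>x. x \<in> V \<Longrightarrow> 0 \<le> h x \<and> h x \<le> 1"
  shows "\<exists>h'. (\<forall>x\<in>V. 0 \<le> h' x \<and> h' x \<le> 1) \<and> sum h' V = sum h V \<and> Q h' \<le> Q h \<and>
    card {x\<in>V. 0 < h' x \<and> h' x < 1} \<le> 1"
  using assms
proof (induction "card {x\<in>V. 0 < h x \<and> h x < 1}" arbitrary: h rule: less_induct)
  case (less h)
  let ?fr = "\<lambda>h. {x\<in>V. 0 < h x \<and> h x < (1::real)}"
  show ?case
  proof (cases "card (?fr h) \<le> 1")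
    case True
    then show ?thesis using less.prems by auto
  next
    case False
    then obtain x y where xy: "x \<in> ?fr h" "y \<in> ?fr h" "x \<noteq> y"
      using card_le_Suc0_iff_eq[of "?fr h"] by auto
    define l where "l = min (h x) (1 - h y)"
    define r where "r = min (1 - h x) (h y)"
    define h1 where "h1 = h(x := h x - l, y := h y + l)"
    define h2 where "h2 = h(x := h x + r, y := h y - r)"
    have lr: "0 < l" "0 < r" using xy by (auto simp: l_def r_def)
    have bd: "\<And>z. z \<in> V \<Longrightarrow> 0 \<le> h1 z \<and> h1 z \<le> 1" "\<And>z. z \<in> V \<Longrightarrow> 0 \<le> h2 z \<and> h2 z \<le> 1"
      using less.prems xy by (auto simp: h1_def h2_def l_def r_def min_def)
    have sums: "sum h1 V = sum h V" "sum h2 V = sum h V"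
    proof -
      have split: "sum g V = g x + g y + sum g (V - {x, y})" for g :: "_ \<Rightarrow> real"
        using xy by (subst sum.subset_diff[of "{x, y}"]) auto
      have "sum h1 (V - {x, y}) = sum h (V - {x, y})" "sum h2 (V - {x, y}) = sum h (V - {x, y})"
        by (auto simp: h1_def h2_def intro!: sum.cong)
      then show "sum h1 V = sum h V" "sum h2 V = sum h V"
        using xy by (simp_all add: split h1_def h2_def)
    qed
    have fr: "card (?fr h1) < card (?fr h)" "card (?fr h2) < card (?fr h)"
    proof -
      have psub: "A \<subset> B" if "A \<subseteq> B" "x \<in> B" "y \<in> B" "\<not> (x \<in> A \<and> y \<in> A)" for A B
        using that by blast
      have "h1 x = 0 \<or> h1 y = 1" "h2 x = 1 \<or> h2 y = 0"
        using xy by (auto simp: h1_def h2_def l_def r_def min_def)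
      then have "\<not> (x \<in> ?fr h1 \<and> y \<in> ?fr h1)" "\<not> (x \<in> ?fr h2 \<and> y \<in> ?fr h2)"
        by auto
      moreover have "?fr h1 \<subseteq> ?fr h" "?fr h2 \<subseteq> ?fr h"
        using xy by (auto simp: h1_def h2_def split: if_splits)
      ultimately have "?fr h1 \<subset> ?fr h" "?fr h2 \<subset> ?fr h"
        using psub[of "?fr h1" "?fr h"] psub[of "?fr h2" "?fr h"] xy(1,2) by simp_all
      moreover have "finite (?fr h)" by simp
      ultimately show "card (?fr h1) < card (?fr h)" "card (?fr h2) < card (?fr h)"
        using psubset_card_mono by blast+
    qed
    have "r * Q h1 + l * Q h2 = (\<Sum>m\<in>V. \<Sum>d\<in>V - {vzero}.
        r * (h1 m * h1 (m \<oplus> d) * h1 (m \<oplus> d \<oplus> d)) + l * (h2 m * h2 (m \<oplus> d) * h2 (m \<oplus> d \<oplus> d)))"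
      by (simp add: Q_def sum_distrib_left sum.distrib)
    also have "\<dots> \<le> (\<Sum>m\<in>V. \<Sum>d\<in>V - {vzero}. (l + r) * (h m * h (m \<oplus> d) * h (m \<oplus> d \<oplus> d)))"
      unfolding h1_def h2_def
      by (intro sum_mono exchange) (use lr xy less.prems add_closed progression_distinct in auto)
    also have "\<dots> = (l + r) * Q h"
      by (simp add: Q_def sum_distrib_left)
    finally have *: "r * Q h1 + l * Q h2 \<le> (l + r) * Q h" .
    have "Q h1 \<le> Q h \<or> Q h2 \<le> Q h"
    proof (rule ccontr)
      assume "\<not> ?thesis"
      then have "r * Q h < r * Q h1" "l * Q h < l * Q h2" using lr by auto
      then show False using * by (simp add: distrib_right)
    qed
    then show ?thesis
    proof
      assume "Q h1 \<le> Q h"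
      then show ?thesis
        using less.hyps[of h1, OF fr(1) bd(1)] sums(1) by (auto intro: order_trans)
    next
      assume "Q h2 \<le> Q h"
      then show ?thesis
        using less.hyps[of h2, OF fr(2) bd(2)] sums(2) by (auto intro: order_trans)
    qed
  qed
qed

text \<open>At most one fractional point remains, and it is rounded up so that the size does not
  drop. It lies on at most 3 p^n nonconstant progressions, and the constant ones contribute at most
  p^n, whence the 4.\<close>

lemma round_to_set:
  assumes h: "\<And>x. x \<in> V \<Longrightarrow> 0 \<le> h x \<and> h x \<le> 1"
  shows "\<exists>S \<subseteq> V. (\<Sum>x\<in>V. h x) \<le> real (card S) \<and>
    T (indicator S) (indicator S) (indicator S) \<le> T h h h + 4 * real p ^ n"
proof -
  obtain g where g: "\<And>x. x \<in> V \<Longrightarrow> 0 \<le> g x \<and> g x \<le> 1" "sum g V = sum h V" "Q g \<le> Q h"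
    "card {x\<in>V. 0 < g x \<and> g x < 1} \<le> 1"
    using round_all_but_one[of h] h by blast
  define E where "E = {x\<in>V. 0 < g x \<and> g x < 1}"
  define S where "S = {x\<in>V. 0 < g x}"
  let ?s = "indicator S :: _ \<Rightarrow> real" and ?e = "indicator E :: _ \<Rightarrow> real"
  have "S \<subseteq> V" "E \<subseteq> V" by (auto simp: S_def E_def)
  have sum_e: "(\<Sum>x\<in>V. ?e x) \<le> 1"
    using g(4) unfolding sum_indicator_V[OF \<open>E \<subseteq> V\<close>] by (simp add: E_def)
  have "sum g V \<le> (\<Sum>x\<in>V. ?s x)"
    using g(1) by (intro sum_mono) (auto simp: indicator_def S_def less_le)
  then have card: "sum h V \<le> real (card S)"
    unfolding sum_indicator_V[OF \<open>S \<subseteq> V\<close>] g(2) .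
  have sg: "?s x = g x \<or> ?e x = 1" if "x \<in> V" for x
    using g(1)[OF that] that by (auto simp: indicator_def S_def E_def)
  have le: "?s a * ?s b * ?s c \<le> g a * g b * g c + (?e a + ?e b + ?e c)"
    if "a \<in> V" "b \<in> V" "c \<in> V" for a b c
  proof (cases "?e a = 1 \<or> ?e b = 1 \<or> ?e c = 1")
    case True
    then have "1 \<le> ?e a + ?e b + ?e c"
      by (auto simp: indicator_def)
    moreover have "?s a * ?s b * ?s c \<le> 1" by (simp add: indicator_def)
    moreover have "0 \<le> g a * g b * g c" using g(1) that by simp
    ultimately show ?thesis by linarith
  next
    case False
    then have "?s a = g a" "?s b = g b" "?s c = g c"
      using sg that by auto
    then show ?thesis by (simp add: indicator_def)
  qed
  have "Q ?s \<le> (\<Sum>m\<in>V. \<Sum>d\<in>V - {vzero}.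
      g m * g (m \<oplus> d) * g (m \<oplus> d \<oplus> d) + (?e m + ?e (m \<oplus> d) + ?e (m \<oplus> d \<oplus> d)))"
    unfolding Q_def by (intro sum_mono le) (auto intro: add_closed)
  also have "\<dots> = Q g + (\<Sum>m\<in>V. \<Sum>d\<in>V - {vzero}. ?e m + ?e (m \<oplus> d) + ?e (m \<oplus> d \<oplus> d))"
    by (simp add: Q_def sum.distrib)
  also have "(\<Sum>m\<in>V. \<Sum>d\<in>V - {vzero}. ?e m + ?e (m \<oplus> d) + ?e (m \<oplus> d \<oplus> d)) \<le>
      (\<Sum>m\<in>V. \<Sum>d\<in>V. ?e m + ?e (m \<oplus> d) + ?e (m \<oplus> d \<oplus> d))"
    by (intro sum_mono sum_mono2) auto
  also have "\<dots> = (\<Sum>d\<in>V. \<Sum>m\<in>V. ?e m + ?e (m \<oplus> d) + ?e (m \<oplus> (d \<oplus> d)))"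
    by (subst sum.swap) (simp add: add_assoc)
  also have "\<dots> = (\<Sum>d\<in>V. 3 * (\<Sum>m\<in>V. ?e m))"
    using sum_shift(1)[OF sg_V, of _ ?e] add_closed by (intro sum.cong refl) (simp add: sum.distrib)
  also have "\<dots> \<le> (\<Sum>d\<in>V. 3)"
    using sum_e by (intro sum_mono) simp
  also have "\<dots> = 3 * real p ^ n"
    by (simp add: card_V)
  finally have Q: "Q ?s \<le> Q h + 3 * real p ^ n" using g(3) by simp
  have "(\<Sum>x\<in>V. ?s x ^ 3) \<le> (\<Sum>x\<in>V. 1)"
    by (intro sum_mono) (simp add: indicator_def)
  then have "T ?s ?s ?s \<le> Q h + 4 * real p ^ n"
    using Q by (simp add: T_eq_Q card_V)
  also have "Q h \<le> T h h h"
    using h by (simp add: T_eq_Q sum_nonneg)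
  finally show ?thesis using card \<open>S \<subseteq> V\<close> by auto
qed

subsection \<open>Critical sets\<close>

lemma varnavides:
  assumes "0 < \<epsilon>" "1 < \<epsilon> + real k * (\<epsilon> ^ 3 / 4)"
    "\<And>x. x \<in> V \<Longrightarrow> 0 \<le> f x \<and> f x \<le> 1" "\<epsilon> * real p ^ n \<le> (\<Sum>x\<in>V. f x)"
  shows "\<epsilon> ^ 3 / 2 / (real p ^ 2) ^ k * (real p ^ n)\<^sup>2 \<le> T f f f"
  using varnavides_aux[OF assms(1) order_refl assms(2) sg_V assms(3)] assms(4) by (simp add: card_V)

text \<open>The perturbation is \<open>\<phi> (1/p - 1\<^sub>H)\<close> for a hyperplane \<open>H\<close> transversal to \<open>W\<close>. Two terms
  of a progression in \<open>H\<close> force the third into \<open>H\<close>, so \<open>\<phi> 1\<^sub>H\<close> carries \<open>p\<^sup>-\<^sup>2\<close> of the progressions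
  of \<open>\<phi>\<close> instead of the \<open>p\<^sup>-\<^sup>3\<close> carried by its average over \<open>W\<close>.\<close>

lemma exists_negative_perturbation:
  assumes W: "sg W" and w0: "w0 \<in> W" "dt t w0 \<noteq> 0" and \<phi>: "inv_under W \<phi>"
  obtains b where "mean_zero W b" "\<And>x. \<bar>b x\<bar> \<le> \<bar>\<phi> x\<bar>"
    "T b b b = - (real p - 1) / real p ^ 3 * T \<phi> \<phi> \<phi>"
proof
  define H where "H = {x\<in>V. dt t x = 0}"
  have H: "sg H" unfolding H_def by (rule sg_ker[OF sg_V])
  define b where "b = (\<lambda>x. \<phi> x * (1 / real p - indicator H x))"
  \<comment> \<open>\<open>e\<close> is \<phi> 1_H; \<open>a\<close> is its average over the cosets
    of \<open>W\<close> and \<open>c\<close> its mean-zero part.\<close>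
  define a where "a = (\<lambda>x. 1 / real p * \<phi> x)"
  define c where "c = (\<lambda>x. - 1 * b x)"
  define e where "e = (\<lambda>x. a x + c x)"
  have e: "e x = indicator H x * \<phi> x" for x
    by (simp add: e_def a_def b_def c_def algebra_simps)
  show mz: "mean_zero W b"
    unfolding mean_zero_def
  proof
    fix x assume x: "x \<in> V"
    have mem: "x \<oplus> w \<in> H \<longleftrightarrow> dt t w = (p - dt t x) mod p" if "w \<in> W" for w
    proof -
      have "x \<oplus> w \<in> V" using that x add_closed sg_sub[OF W] by auto
      moreover have "(dt t x + dt t w) mod p = 0 \<longleftrightarrow> dt t w = (p - dt t x) mod p"
        using dt_less[of t x] dt_less[of t w]
        by (cases "dt t x = 0"; cases "dt t x + dt t w < p") (auto simp: mod_if)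
      ultimately show ?thesis by (simp add: H_def dt_add)
    qed
    have "(\<Sum>w\<in>W. indicator H (x \<oplus> w)) = (\<Sum>w\<in>{w\<in>W. dt t w = (p - dt t x) mod p}. 1 :: real)"
      using sg_finite[OF W] mem by (intro sum.mono_neutral_cong_right) (auto simp: indicator_def)
    also have "\<dots> = real (card W) / real p"
      using fibre_card[OF W w0, of "(p - dt t x) mod p"] p_gt_2
      by (simp add: field_simps flip: of_nat_mult)
    finally have ind: "(\<Sum>w\<in>W. indicator H (x \<oplus> w)) = real (card W) / real p" .
    have "(\<Sum>w\<in>W. b (x \<oplus> w)) = (\<Sum>w\<in>W. \<phi> x * (1 / real p - indicator H (x \<oplus> w)))"
      using \<phi> x by (intro sum.cong refl) (simp add: b_def inv_under_def)
    also have "\<dots> = \<phi> x * (real (card W) / real p - (\<Sum>w\<in>W. indicator H (x \<oplus> w)))"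
      by (simp only: sum_distrib_left[symmetric] sum_subtractf) simp
    finally show "(\<Sum>w\<in>W. b (x \<oplus> w)) = 0" by (simp add: ind)
  qed
  show "\<bar>b x\<bar> \<le> \<bar>\<phi> x\<bar>" for x
  proof -
    have "\<bar>1 / real p - indicator H x\<bar> \<le> 1"
      using p_gt_2 by (auto simp: indicator_def abs_if)
    then show ?thesis
      by (simp add: b_def abs_mult mult_left_le)
  qed
  have mz_c: "mean_zero W c"
    using mz by (simp add: mean_zero_def c_def sum_negf)
  have inv_a: "inv_under W a"
    using \<phi> by (simp add: inv_under_def a_def)
  have "e m * e (m \<oplus> d) * e (m \<oplus> d \<oplus> d) = e m * e (m \<oplus> d) * \<phi> (m \<oplus> d \<oplus> d)"
    if "m \<in> V" "d \<in> V" for m d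
  proof (cases "m \<in> H \<and> m \<oplus> d \<in> H")
    case True
    then have "m \<oplus> d \<oplus> d \<in> H"
      using that sg_mem_iff[OF H, of d m] sg_mem_iff[OF H, of d "m \<oplus> d"] add_comm by metis
    then show ?thesis by (simp add: e)
  qed (auto simp: e)
  then have "T e e e = T e e \<phi>"
    unfolding T_def by (intro sum.cong refl)
  \<comment> \<open>With the invariant \<phi> in the third slot every term containing
    \<open>c\<close> vanishes, so exactly two factors 1/p remain.\<close>
  also have "\<dots> = T a a \<phi>"
    unfolding e_def T_add1 T_add2
    using T_cross[OF W, of _ _ \<phi>] \<phi> mz_c by simp
  also have "\<dots> = T \<phi> \<phi> \<phi> / (real p)\<^sup>2"
    using T_scale[of "1 / real p" \<phi> "1 / real p" \<phi> 1 \<phi>] by (simp add: a_def power2_eq_square)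
  finally have Te: "T e e e = T \<phi> \<phi> \<phi> / (real p)\<^sup>2" .
  have "T e e e = T a a a + T c c c"
    unfolding e_def by (rule T_split[OF W inv_a mz_c])
  also have "\<dots> = T \<phi> \<phi> \<phi> / real p ^ 3 - T b b b"
    unfolding a_def c_def T_scale by (simp add: power3_eq_cube)
  finally have "T b b b = T \<phi> \<phi> \<phi> / real p ^ 3 - T \<phi> \<phi> \<phi> / (real p)\<^sup>2"
    using Te by simp
  then show "T b b b = - (real p - 1) / real p ^ 3 * T \<phi> \<phi> \<phi>"
    using p_gt_2 by (simp add: field_simps power2_eq_square power3_eq_cube)
qed

text \<open>Were the mean of \<phi> at least \<epsilon>, the perturbation would save at least the
  right side of \<open>small\<close> times p^(2n). On that scale, averaging \<open>S\<close> costs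
  at most \<open>sqrt \<eta>\<close> and rounding at most \<open>4 / p ^ n\<close>, so
  \<open>small\<close> says that the saving wins. The nonzero \<open>w0\<close> provides a
  hyperplane not containing \<open>W\<close>.\<close>

lemma critical_average_nearly_indicator:
  assumes "0 < \<epsilon>" "1 < \<epsilon> + real k * (\<epsilon> ^ 3 / 4)" "0 < \<eta>"
    and small: "sqrt \<eta> + 4 / real p ^ n < \<epsilon> ^ 3 / 2 / (real p ^ 2) ^ k * ((real p - 1) / real p ^ 3)"
    and "S \<subseteq> V"
    and min: "\<And>S'. S' \<subseteq> V \<Longrightarrow> card S \<le> card S' \<Longrightarrow>
      T (indicator S) (indicator S) (indicator S) \<le> T (indicator S') (indicator S') (indicator S')"
    and W: "sg W" and w0: "w0 \<in> W" "w0 \<noteq> vzero"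
    and reg: "\<And>t. t \<in> V \<Longrightarrow>
      norm (F (\<lambda>x. indicator S x - avg W (indicator S) x) t) \<le> sqrt \<eta> * real p ^ n"
  shows "(\<Sum>x\<in>V. avg W (indicator S) x * (1 - avg W (indicator S) x)) < \<epsilon> * real p ^ n"
proof (rule ccontr)
  let ?f = "indicator S :: _ \<Rightarrow> real"
  define g where "g = avg W ?f"
  define v where "v = (\<lambda>x. ?f x - g x)"
  define \<phi> where "\<phi> = (\<lambda>x. g x * (1 - g x))"
  define P where "P = real p ^ n"
  define \<kappa> where "\<kappa> = (real p - 1) / real p ^ 3"
  define \<delta> where "\<delta> = \<epsilon> ^ 3 / 2 / (real p ^ 2) ^ k"
  have P: "0 < P" using p_gt_2 by (simp add: P_def)
  have \<kappa>: "0 < \<kappa>" using p_gt_2 by (simp add: \<kappa>_def)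
  have g: "0 \<le> g x" "g x \<le> 1" if "x \<in> V" for x
    unfolding g_def using avg_bounds[OF W _ that, of ?f] by (simp_all add: indicator_def)
  have inv_g: "inv_under W g" unfolding g_def by (rule avg_inv_under[OF W])
  then have inv_\<phi>: "inv_under W \<phi>" by (simp add: inv_under_def \<phi>_def)
  have \<phi>: "0 \<le> \<phi> x" "\<phi> x \<le> g x" "\<phi> x \<le> 1 - g x" if "x \<in> V" for x
    using g[OF that] by (auto simp: \<phi>_def mult_left_le mult_left_le_one_le)
  assume "\<not> ?thesis"
  then have "\<epsilon> * real p ^ n \<le> (\<Sum>x\<in>V. \<phi> x)"
    by (simp add: \<phi>_def g_def)
  then have T\<phi>: "\<delta> * P\<^sup>2 \<le> T \<phi> \<phi> \<phi>"
    unfolding \<delta>_def P_def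
    using \<phi>(1) order_trans[OF \<phi>(2) g(2)] by (intro varnavides[OF assms(1,2)]) auto
  have "\<bar>v x\<bar> \<le> 1" if "x \<in> V" for x
    using g[OF that] by (auto simp: v_def indicator_def)
  then have "(\<Sum>x\<in>V. (v x)\<^sup>2) \<le> (\<Sum>x\<in>V. 1)"
    by (intro sum_mono) (simp add: abs_square_le_1)
  then have "(\<Sum>x\<in>V. (v x)\<^sup>2) \<le> P" by (simp add: card_V P_def)
  then have "sqrt \<eta> * P * (\<Sum>x\<in>V. (v x)\<^sup>2) \<le> sqrt \<eta> * P * P"
    using P \<open>0 < \<eta>\<close> by (intro mult_left_mono) auto
  then have Tv: "- (sqrt \<eta> * P\<^sup>2) \<le> T v v v"
    using T_bound[of v "sqrt \<eta> * P"] reg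
    by (simp add: v_def g_def P_def power2_eq_square mult.assoc)
  have mz_v: "mean_zero W v"
    unfolding v_def g_def by (rule mean_zero_diff_avg[OF W])
  have "T ?f ?f ?f = T (\<lambda>x. g x + v x) (\<lambda>x. g x + v x) (\<lambda>x. g x + v x)"
    by (simp add: v_def)
  then have Tf: "T ?f ?f ?f = T g g g + T v v v"
    using T_split[OF W inv_g mz_v] by simp
  obtain t where "dt t w0 \<noteq> 0"
    using dt_nondegenerate[of w0] w0 sg_sub[OF W] by auto
  then obtain b where b: "mean_zero W b" "\<And>x. \<bar>b x\<bar> \<le> \<bar>\<phi> x\<bar>"
      "T b b b = - (real p - 1) / real p ^ 3 * T \<phi> \<phi> \<phi>"
    using exists_negative_perturbation[OF W w0(1) _ inv_\<phi>] by metis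
  define h where "h = (\<lambda>x. g x + b x)"
  have "0 \<le> h x \<and> h x \<le> 1" if "x \<in> V" for x
    using \<phi>[OF that] b(2)[of x] by (auto simp: h_def)
  then obtain S' where S': "S' \<subseteq> V" "(\<Sum>x\<in>V. h x) \<le> real (card S')"
      "T (indicator S') (indicator S') (indicator S') \<le> T h h h + 4 * P"
    using round_to_set[of h] unfolding P_def by blast
  \<comment> \<open>Averaging preserves the total and \<open>b\<close> adds zero to it, so
    \<open>S'\<close> is at least as large as \<open>S\<close> and minimality applies.\<close>
  have "(\<Sum>x\<in>V. h x) = (\<Sum>x\<in>V. g x * 1)"
    using sum_mean_zero[OF W b(1)] by (simp add: h_def sum.distrib)
  also have "\<dots> = (\<Sum>x\<in>V. ?f x * 1)"
    unfolding g_def by (rule sum_avg[OF W]) (simp add: inv_under_def)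
  also have "\<dots> = real (card S)"
    using sum_indicator_V[OF \<open>S \<subseteq> V\<close>] by simp
  finally have "card S \<le> card S'" using S'(2) by simp
  then have "T ?f ?f ?f \<le> T h h h + 4 * P"
    using min[OF S'(1)] S'(3) by linarith
  also have "T h h h = T g g g + T b b b"
    unfolding h_def by (rule T_split[OF W inv_g b(1)])
  also have "T b b b = - (\<kappa> * T \<phi> \<phi> \<phi>)"
    unfolding b(3) \<kappa>_def by (simp only: minus_divide_left[symmetric] mult_minus_left)
  finally have "\<kappa> * T \<phi> \<phi> \<phi> \<le> sqrt \<eta> * P\<^sup>2 + 4 * P"
    using Tf Tv by linarith
  moreover have "\<kappa> * (\<delta> * P\<^sup>2) \<le> \<kappa> * T \<phi> \<phi> \<phi>"
    using T\<phi> \<kappa> by (intro mult_left_mono) auto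
  moreover have "(sqrt \<eta> + 4 / P) * P\<^sup>2 < \<delta> * \<kappa> * P\<^sup>2"
    using small P unfolding P_def \<delta>_def \<kappa>_def by (intro mult_strict_right_mono) auto
  moreover have "(sqrt \<eta> + 4 / P) * P\<^sup>2 = sqrt \<eta> * P\<^sup>2 + 4 * P"
    using P by (simp add: field_simps power2_eq_square)
  ultimately show False by (simp add: mult_ac)
qed

text \<open>Keeping the cosets with g >= 1/2 misclassifies a proportion min(g, 1 - g) of each coset,
  which is at most 2g(1 - g); hence the bound 2\<epsilon>.\<close>

lemma critical_structure:
  assumes "0 < \<epsilon>" "1 < \<epsilon> + real k * (\<epsilon> ^ 3 / 4)" "0 < \<eta>"
    and "sqrt \<eta> + 4 / real p ^ n < \<epsilon> ^ 3 / 2 / (real p ^ 2) ^ k * ((real p - 1) / real p ^ 3)"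
    and n: "1 / \<eta> < real n" and S: "S \<subseteq> V"
    and "\<And>S'. S' \<subseteq> V \<Longrightarrow> card S \<le> card S' \<Longrightarrow>
      T (indicator S) (indicator S) (indicator S) \<le> T (indicator S') (indicator S') (indicator S')"
  shows "\<exists>W A. sg W \<and> real n - 1 / \<eta> \<le> real (sub_dim p W) \<and> A \<subseteq> V \<and>
    real (card A) \<le> real p powr (1 / \<eta>) \<and>
    real (card (S \<union> sumset p A W - S \<inter> sumset p A W)) \<le> 2 * \<epsilon> * real p ^ n"
proof -
  let ?f = "indicator S :: _ \<Rightarrow> real"
  obtain W where W: "sg W" and dim: "real n - 1 / \<eta> \<le> real (sub_dim p W)"
    and reg: "\<And>t. t \<in> V \<Longrightarrow> norm (F (\<lambda>x. ?f x - avg W ?f x) t) \<le> sqrt \<eta> * real p ^ n"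
    using regular_subgroup[of ?f \<eta>] \<open>0 < \<eta>\<close> by (auto simp: indicator_def)
  \<comment> \<open>Codimension at most 1/\<eta> < n leaves a nonzero vector in
    \<open>W\<close>.\<close>
  have "W \<noteq> {vzero}"
  proof
    assume "W = {vzero}"
    then have "sub_dim p W = 0" by (intro sub_dim_eqI) simp
    then show False using dim n by simp
  qed
  then obtain w0 where w0: "w0 \<in> W" "w0 \<noteq> vzero"
    using sg_zero[OF W] by blast
  define g where "g = avg W ?f"
  have \<phi>: "(\<Sum>x\<in>V. g x * (1 - g x)) < \<epsilon> * real p ^ n"
    unfolding g_def using assms(1-4,6-) W w0 reg by (rule critical_average_nearly_indicator)
  define B where "B = {x\<in>V. 1 / 2 \<le> g x}"
  let ?b = "indicator B :: _ \<Rightarrow> real"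
  have g: "0 \<le> g x" "g x \<le> 1" if "x \<in> V" for x
    unfolding g_def using avg_bounds[OF W _ that, of ?f] by (simp_all add: indicator_def)
  have inv_g: "inv_under W g" unfolding g_def by (rule avg_inv_under[OF W])
  have inv_B: "x \<oplus> w \<in> B \<longleftrightarrow> x \<in> B" if "x \<in> V" "w \<in> W" for x w
    using that inv_g sg_sub[OF W] add_closed by (auto simp: B_def inv_under_def)
  have BV: "B \<subseteq> V" by (auto simp: B_def)
  have "\<exists>A \<subseteq> B. sumset p A W = B \<and> card A * card W = card B"
    by (rule exists_transversal[OF W BV]) (use inv_B BV in blast)
  then obtain A where A: "A \<subseteq> B" "sumset p A W = B" "card A * card W = card B" by auto
  have "card A * p ^ sub_dim p W \<le> p ^ n"
    using A(3) card_mono[OF finite_V BV] by (simp add: card_sg[OF W, symmetric] card_V)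
  then have "real (card A) * real p ^ sub_dim p W \<le> real p ^ n"
    by (metis of_nat_le_iff of_nat_mult of_nat_power)
  then have "real (card A) \<le> real p ^ n / real p ^ sub_dim p W"
    using p_gt_2 by (simp add: field_simps)
  also have "\<dots> = real p powr (real n - real (sub_dim p W))"
    using p_gt_2 by (simp add: powr_diff powr_realpow)
  also have "\<dots> \<le> real p powr (1 / \<eta>)"
    using dim p_gt_2 by (intro powr_mono) auto
  finally have card_A: "real (card A) \<le> real p powr (1 / \<eta>)" .
  have "real (card (S \<union> B - S \<inter> B)) = (\<Sum>x\<in>V. indicator (S \<union> B - S \<inter> B) x)"
    using S BV by (intro sum_indicator_V[symmetric]) auto
  \<comment> \<open>This form is linear in the indicator of \<open>S\<close> with coset-invariant
    weights, so \<open>sum_avg\<close> can put \<open>g\<close> in its place.\<close>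
  also have "\<dots> = (\<Sum>x\<in>V. ?f x * (1 - 2 * ?b x) + ?b x)"
    by (intro sum.cong refl) (auto simp: indicator_def)
  also have "\<dots> = (\<Sum>x\<in>V. g x * (1 - 2 * ?b x)) + (\<Sum>x\<in>V. ?b x)"
    unfolding sum.distrib g_def
    by (subst sum_avg[OF W]) (auto simp: inv_under_def inv_B indicator_def)
  also have "\<dots> = (\<Sum>x\<in>V. g x * (1 - 2 * ?b x) + ?b x)"
    by (rule sum.distrib[symmetric])
  also have "\<dots> \<le> (\<Sum>x\<in>V. 2 * (g x * (1 - g x)))"
  proof (rule sum_mono)
    fix x assume x: "x \<in> V"
    show "g x * (1 - 2 * ?b x) + ?b x \<le> 2 * (g x * (1 - g x))"
    proof (cases "x \<in> B")
      case True
      then have "0 \<le> (2 * g x - 1) * (1 - g x)"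
        using g[OF x] by (intro mult_nonneg_nonneg) (auto simp: B_def)
      then show ?thesis using True by (simp add: algebra_simps)
    next
      case False
      then have "0 \<le> g x * (1 - 2 * g x)"
        using g[OF x] x by (intro mult_nonneg_nonneg) (auto simp: B_def)
      then show ?thesis using False by (simp add: algebra_simps)
    qed
  qed
  also have "\<dots> = 2 * (\<Sum>x\<in>V. g x * (1 - g x))"
    by (simp add: sum_distrib_left)
  also have "\<dots> \<le> 2 * \<epsilon> * real p ^ n"
    using \<phi> by simp
  finally show ?thesis
    using W dim A BV card_A by blast
qed

end

section \<open>From a fixed error to null sequences\<close>

text \<open>Take the infimum of the admissible errors, plus 1/(n+1) because it need not be attained.
  The error 1 keeps the set of admissible errors nonempty for every \<open>n\<close>.\<close>

lemma exists_null_sequence: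
  fixes P :: "real \<Rightarrow> nat \<Rightarrow> bool"
  assumes mono: "\<And>e e' n. P e n \<Longrightarrow> e \<le> e' \<Longrightarrow> P e' n" and one: "\<And>n. P 1 n"
    and small: "\<And>e. 0 < e \<Longrightarrow> eventually (P e) sequentially"
  shows "\<exists>c. c \<longlonglongrightarrow> 0 \<and> (\<forall>n. P (c n) n)"
proof -
  define I where "I n = Inf {e. 0 \<le> e \<and> P e n}" for n
  have bdd: "bdd_below {e. 0 \<le> e \<and> P e n}" for n
    by (rule bdd_belowI[of _ 0]) auto
  have ne: "{e. 0 \<le> e \<and> P e n} \<noteq> {}" for n
    using one[of n] by (auto intro!: exI[of _ 1])
  have I_nonneg: "0 \<le> I n" for n
    unfolding I_def using ne by (intro cInf_greatest) auto
  have "I \<longlonglongrightarrow> 0"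
  proof (rule LIMSEQ_I)
    fix r :: real assume "0 < r"
    then have "eventually (\<lambda>n. P (r / 2) n) sequentially" by (intro small) simp
    then obtain N where N: "\<And>n. n \<ge> N \<Longrightarrow> P (r / 2) n"
      by (auto simp: eventually_sequentially)
    have "norm (I n - 0) < r" if "n \<ge> N" for n
    proof -
      have "I n \<le> r / 2"
        unfolding I_def using N[OF that] \<open>0 < r\<close> by (intro cInf_lower bdd) auto
      then show ?thesis using I_nonneg[of n] \<open>0 < r\<close> by simp
    qed
    then show "\<exists>N. \<forall>n\<ge>N. norm (I n - 0) < r" by blast
  qed
  then have "(\<lambda>n. I n + inverse (real (Suc n))) \<longlonglongrightarrow> 0 + 0"
    by (intro tendsto_add LIMSEQ_inverse_real_of_nat)
  moreover have "P (I n + inverse (real (Suc n))) n" for n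
  proof -
    have "Inf {e. 0 \<le> e \<and> P e n} < I n + inverse (real (Suc n))"
      by (simp add: I_def)
    then obtain e where "e \<in> {e. 0 \<le> e \<and> P e n}" "e < I n + inverse (real (Suc n))"
      using cInf_lessD[OF ne] by blast
    then show ?thesis using mono by auto
  qed
  ultimately show ?thesis by auto
qed

definition critical :: "nat \<Rightarrow> real \<Rightarrow> nat \<Rightarrow> (nat \<Rightarrow> nat) set \<Rightarrow> bool" where
  "critical p \<alpha> n S \<longleftrightarrow> S \<subseteq> Vsp p n \<and> real (card S) \<ge> \<alpha> * real p ^ n \<and>
    (\<forall>S'. S' \<subseteq> Vsp p n \<and> real (card S') \<ge> \<alpha> * real p ^ n \<longrightarrow>
      Lambda3 p n (indicator S) \<le> Lambda3 p n (indicator S'))"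

text \<open>One \<open>e\<close> bounds all three errors at once, which makes the property monotone
  in \<open>e\<close> and fit for \<open>exists_null_sequence\<close>.\<close>

definition coset_structured :: "nat \<Rightarrow> real \<Rightarrow> nat \<Rightarrow> (nat \<Rightarrow> nat) set \<Rightarrow> bool" where
  "coset_structured p e n S \<longleftrightarrow> (\<exists>W A. is_subgroup p n W \<and>
    real (sub_dim p W) \<ge> real n - e * real n \<and>
    A \<subseteq> Vsp p n \<and> real (card A) \<le> real p powr (e * real n) \<and>
    real (card (S \<union> sumset p A W - S \<inter> sumset p A W)) \<le> e * real p ^ n)"

lemma (in fpn) critical_coset_structured:
  assumes "critical p \<alpha> n S" "0 < \<epsilon>" "1 < \<epsilon> + real k * (\<epsilon> ^ 3 / 4)" "0 < \<eta>"
    and "sqrt \<eta> + 4 / real p ^ n < \<epsilon> ^ 3 / 2 / (real p ^ 2) ^ k * ((real p - 1) / real p ^ 3)"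
    and "1 / \<eta> < real n" "1 / \<eta> \<le> 2 * \<epsilon> * real n"
  shows "coset_structured p (2 * \<epsilon>) n S"
proof -
  have S: "S \<subseteq> V" and crit: "\<alpha> * real p ^ n \<le> real (card S)"
    "\<And>S'. S' \<subseteq> V \<Longrightarrow> \<alpha> * real p ^ n \<le> real (card S') \<Longrightarrow>
      Lambda3 p n (indicator S) \<le> Lambda3 p n (indicator S')"
    using assms(1) by (auto simp: critical_def)
  have "T (indicator S) (indicator S) (indicator S) \<le> T (indicator S') (indicator S') (indicator S')"
    if "S' \<subseteq> V" "card S \<le> card S'" for S'
    using crit(1) crit(2)[OF that(1)] that(2) p_gt_2
    by (simp add: Lambda3_eq divide_le_cancel zero_less_power)
  then obtain W A where WA: "sg W" "real n - 1 / \<eta> \<le> real (sub_dim p W)" "A \<subseteq> V"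
    "real (card A) \<le> real p powr (1 / \<eta>)"
    "real (card (S \<union> sumset p A W - S \<inter> sumset p A W)) \<le> 2 * \<epsilon> * real p ^ n"
    using critical_structure[OF assms(2-6) S] by blast
  have "real p powr (1 / \<eta>) \<le> real p powr (2 * \<epsilon> * real n)"
    using assms(7) p_gt_2 by (intro powr_mono) auto
  then show ?thesis
    unfolding coset_structured_def using WA assms(7)
    by (intro exI[of _ W] exI[of _ A]) auto
qed

lemma eventually_critical_coset_structured:
  assumes "prime p" "odd p" "0 < e"
  shows "\<forall>\<^sub>F n in sequentially. \<forall>S. critical p \<alpha> n S \<longrightarrow> coset_structured p e n S"
proof -
  have p_gt_2: "p > 2"
    using fpn.p_gt_2[of p] assms by (simp add: fpn_def)
  \<comment> \<open>Halving absorbs the factor 2 in the bound for the symmetric difference.\<close>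
  define \<epsilon> where "\<epsilon> = e / 2"
  have \<epsilon>: "0 < \<epsilon>" using assms by (simp add: \<epsilon>_def)
  then obtain k where "1 < real k * (\<epsilon> ^ 3 / 4)"
    using ex_less_of_nat_mult[of "\<epsilon> ^ 3 / 4" 1] by auto
  then have k: "1 < \<epsilon> + real k * (\<epsilon> ^ 3 / 4)" using \<epsilon> by simp
  define \<kappa> where "\<kappa> = \<epsilon> ^ 3 / 2 / (real p ^ 2) ^ k * ((real p - 1) / real p ^ 3)"
  have \<kappa>: "0 < \<kappa>" using \<epsilon> p_gt_2 by (simp add: \<kappa>_def)
  \<comment> \<open>Half of \<kappa> is spent on the Fourier error \<open>sqrt \<eta>\<close>; the
    other half exceeds the rounding error \<open>4 / p ^ n\<close> once
    \<open>n > 8 / \<kappa>\<close>, since p^n > n.\<close>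
  define \<eta> where "\<eta> = (\<kappa> / 2)\<^sup>2"
  have \<eta>: "0 < \<eta>" "sqrt \<eta> = \<kappa> / 2" using \<kappa> by (simp_all add: \<eta>_def real_sqrt_abs)
  have "\<forall>\<^sub>F n in sequentially. 8 / \<kappa> < real n" "\<forall>\<^sub>F n in sequentially. 1 / \<eta> < real n"
    "\<forall>\<^sub>F n in sequentially. 1 / \<eta> / e < real n"
    using filterlim_real_sequentially by (simp_all add: filterlim_at_top_dense)
  then show ?thesis
  proof eventually_elim
    case (elim n)
    have "real n < 2 ^ n" by (rule of_nat_less_two_power)
    also have "2 ^ n \<le> real p ^ n" using p_gt_2 by (intro power_mono) auto
    finally have "8 / \<kappa> < real p ^ n" using elim(1) by linarith
    then have "4 / real p ^ n < \<kappa> / 2"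
      using \<kappa> p_gt_2 by (simp add: field_simps)
    then have small: "sqrt \<eta> + 4 / real p ^ n < \<kappa>" using \<eta> by simp
    have large: "1 / \<eta> \<le> 2 * \<epsilon> * real n"
      using elim(3) unfolding pos_divide_less_eq[OF assms(3)] by (simp add: \<epsilon>_def mult.commute)
    interpret fpn p n using assms by unfold_locales
    show ?case
      using critical_coset_structured[OF _ \<epsilon> k \<eta>(1) small[unfolded \<kappa>_def] elim(2) large]
      by (simp add: \<epsilon>_def)
  qed
qed

lemma coset_structured_mono:
  assumes "coset_structured p e n S" "e \<le> e'" "0 < p" shows "coset_structured p e' n S"
proof -
  have "e * real n \<le> e' * real n" "e * real p ^ n \<le> e' * real p ^ n"
    using assms(2) by (auto intro: mult_right_mono)
  moreover from this have "real p powr (e * real n) \<le> real p powr (e' * real n)"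
    using assms(3) by (intro powr_mono) auto
  ultimately show ?thesis
    using assms(1) unfolding coset_structured_def by (meson diff_left_mono order_trans)
qed

text \<open>The trivial subgroup with \<open>A = S\<close> reproduces \<open>S\<close> exactly, and
  error 1 tolerates full codimension and p^n translates. This covers the \<open>n\<close> too small
  for the main argument.\<close>

lemma (in fpn) coset_structured_one:
  assumes "S \<subseteq> V" shows "coset_structured p 1 n S"
proof -
  have "sg {vzero}"
    by (simp add: is_subgroup_def add_zero)
  moreover have "sumset p S {vzero} = S"
    using assms add_zero by (auto simp: sumset_def) (metis add_zero subsetD)
  moreover have "real (card S) \<le> real p powr real n"
    using card_mono[OF finite_V assms] p_gt_2
    by (simp add: card_V powr_realpow flip: of_nat_power)
  ultimately show ?thesis
    unfolding coset_structured_def using assms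
    by (intro exI[of _ "{vzero}"] exI[of _ S]) simp
qed

theorem theorem1:
  fixes p :: nat and \<alpha> :: real
  assumes "prime p" and "odd p" and "0 < \<alpha>" and "\<alpha> \<le> 1"
  shows "\<exists>a b c :: nat \<Rightarrow> real.
           a \<longlonglongrightarrow> 0 \<and> b \<longlonglongrightarrow> 0 \<and> c \<longlonglongrightarrow> 0 \<and>
           (\<forall>n S. S \<subseteq> Vsp p n \<and> real (card S) \<ge> \<alpha> * real p ^ n \<and>
              (\<forall>S'. S' \<subseteq> Vsp p n \<and> real (card S') \<ge> \<alpha> * real p ^ n \<longrightarrow>
                 Lambda3 p n (indicator S) \<le> Lambda3 p n (indicator S'))
            \<longrightarrow> (\<exists>W A. is_subgroup p n W \<and> real (sub_dim p W) \<ge> real n - a n * real n \<and>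
                      A \<subseteq> Vsp p n \<and> real (card A) \<le> real p powr (b n * real n) \<and>
                      real (card (S \<union> sumset p A W - S \<inter> sumset p A W)) \<le> c n * real p ^ n))"
proof -
  have "\<exists>c. c \<longlonglongrightarrow> 0 \<and> (\<forall>n. \<forall>S. critical p \<alpha> n S \<longrightarrow> coset_structured p (c n) n S)"
  proof (rule exists_null_sequence)
    show "\<forall>S. critical p \<alpha> n S \<longrightarrow> coset_structured p 1 n S" for n
    proof -
      interpret fpn p n using assms by unfold_locales
      show ?thesis using coset_structured_one by (simp add: critical_def)
    qed
    show "\<forall>S. critical p \<alpha> n S \<longrightarrow> coset_structured p e' n S"
      if "\<forall>S. critical p \<alpha> n S \<longrightarrow> coset_structured p e n S" "e \<le> e'" for e e' n
      using that coset_structured_mono prime_gt_0_nat[OF assms(1)] by blast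
  qed (rule eventually_critical_coset_structured[OF assms(1,2)])
  then obtain c where "c \<longlonglongrightarrow> 0" "\<And>n S. critical p \<alpha> n S \<Longrightarrow> coset_structured p (c n) n S"
    by blast
  \<comment> \<open>The same null sequence serves as \<open>a\<close>, \<open>b\<close> and
    \<open>c\<close>.\<close>
  then show ?thesis
    unfolding critical_def coset_structured_def by (intro exI[of _ c]) blast
qed

end
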